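(* Let $1\le p\le\infty$, let $p'$ be defined by $\frac1p+\frac1{p'}=1$, let $n\in\mathbb N$, and let $\bar\beta=\{\beta_k\}_{k=1}^\infty$ be an arbitrary sequence of real numbers. Then for $r\ge n+1$ the following estimates hold: $$\varepsilon_{n}(W^r_{\bar\beta,p})_{C}= n^{-r}\Bigg(\frac{\|\cos t\|_{p'}}{\pi} +O(1)\bigg(1+\frac1n\bigg)^{-r}\Bigg)$$ and $$\varepsilon_{n}(W^r_{\bar\beta,1})_{L_p}= n^{-r}\Bigg(\frac{\|\cos t\|_{p}}{\pi} +O(1)\bigg(1+\frac1n\bigg)^{-r}\Bigg),$$ where $O(1)$ denotes quantities bounded in absolute value by a constant independent of $n$, $r$, $p$ and $\bar\beta$.
   Context: $C$ is the space of continuous $2\pi$-periodic functions with norm $\|f\|_C=\max_t|f(t)|$; $L_p$ ($1\le p<\infty$) is the space of $2\pi$-periodic functions with $\|f\|_p=\big(\int_{-\pi}^{\pi}|f(t)|^pdt\big)^{1/p}<\infty$, and $L_\infty$ is the space of essentially bounded measurable $2\pi$-periodic functions with $\|f\|_\infty=\operatorname{ess\,sup}_t|f(t)|$. In particular $\|\cos t\|_{q}$ denotes the $L_q$-norm of $\cos t$ over $[-\pi,\pi)$. Let $U_p^0=\{\varphi\in L_p:\ \|\varphi\|_p\le 1,\ \int_{-\pi}^{\pi}\varphi(t)\,dt=0\}$. For $r>1$ and a real sequence $\bar\beta=\{\beta_k\}_{k\ge1}$, let $\Psi_{\bar\beta}(t)=\sum_{k=1}^\infty k^{-r}\cos\big(kt-\frac{\beta_k\pi}{2}\big)$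 (a continuous function). The class $W^r_{\bar\beta,p}$ is the set of all $2\pi$-periodic functions $f$ representable for all $x\in\mathbb R$ as $f(x)=\frac{a_0}{2}+\frac1\pi\int_{-\pi}^{\pi}\Psi_{\bar\beta}(x-t)\varphi(t)\,dt$ with $a_0\in\mathbb R$ and $\varphi\in U_p^0$. For a set $\mathfrak N$ and $X=C$ or $X=L_p$, $\varepsilon_n(\mathfrak N)_X=\sup_{f\in\mathfrak N}\|f-S_{n-1}(f)\|_X$, where $S_{n-1}(f;\cdot)$ is the partial Fourier sum of order $n-1$ of $f$. *)

theory Defs
  imports "HOL-Analysis.Analysis" "HOL-Probability.Essential_Supremum"
begin

(* p ranges over [1, \<infinity>] as an extended real *)

definition conj_exp :: "ereal \<Rightarrow> ereal" where
  "conj_exp p = (if p = 1 then \<infinity> else if p = \<infinity> then 1 else p / (p - 1))"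

definition per2pi :: "(real \<Rightarrow> real) \<Rightarrow> bool" where
  "per2pi g \<longleftrightarrow> (\<forall>t. g (t + 2 * pi) = g t)"

definition lpnorm :: "ereal \<Rightarrow> (real \<Rightarrow> real) \<Rightarrow> ereal" where
  "lpnorm p g =
    (if p = \<infinity> then esssup (lebesgue_on {-pi..pi}) (\<lambda>t. ereal \<bar>g t\<bar>)
     else if integrable (lebesgue_on {-pi..pi}) (\<lambda>t. \<bar>g t\<bar> powr real_of_ereal p)
     then ereal ((\<integral>t. \<bar>g t\<bar> powr real_of_ereal p \<partial>lebesgue_on {-pi..pi}) powr (1 / real_of_ereal p))
     else \<infinity>)"

definition cnorm :: "(real \<Rightarrow> real) \<Rightarrow> ereal" where
  "cnorm g = (SUP t. ereal \<bar>g t\<bar>)"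

definition in_Lp :: "ereal \<Rightarrow> (real \<Rightarrow> real) \<Rightarrow> bool" where
  "in_Lp p g \<longleftrightarrow> g \<in> borel_measurable lebesgue \<and> per2pi g \<and>
     (if p = \<infinity> then esssup (lebesgue_on {-pi..pi}) (\<lambda>t. ereal \<bar>g t\<bar>) < \<infinity>
      else integrable (lebesgue_on {-pi..pi}) (\<lambda>t. \<bar>g t\<bar> powr real_of_ereal p))"

definition U0 :: "ereal \<Rightarrow> (real \<Rightarrow> real) set" where
  "U0 p = {\<phi>. in_Lp p \<phi> \<and> lpnorm p \<phi> \<le> 1 \<and> (\<integral>t. \<phi> t \<partial>lebesgue_on {-pi..pi}) = 0}"

definition Psi :: "(nat \<Rightarrow> real) \<Rightarrow> real \<Rightarrow> real \<Rightarrow> real" where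
  "Psi \<beta> r t = (\<Sum>k. real (Suc k) powr (-r) * cos (real (Suc k) * t - \<beta> (Suc k) * pi / 2))"

definition Wclass :: "(nat \<Rightarrow> real) \<Rightarrow> real \<Rightarrow> ereal \<Rightarrow> (real \<Rightarrow> real) set" where
  "Wclass \<beta> r p = {f. \<exists>a0 \<phi>. \<phi> \<in> U0 p \<and>
      (\<forall>x. f x = a0 / 2 + 1 / pi * (\<integral>t. Psi \<beta> r (x - t) * \<phi> t \<partial>lebesgue_on {-pi..pi}))}"

definition fcos :: "(real \<Rightarrow> real) \<Rightarrow> nat \<Rightarrow> real" where
  "fcos f k = 1 / pi * (\<integral>t. f t * cos (real k * t) \<partial>lebesgue_on {-pi..pi})"

definition fsin :: "(real \<Rightarrow> real) \<Rightarrow> nat \<Rightarrow> real" where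
  "fsin f k = 1 / pi * (\<integral>t. f t * sin (real k * t) \<partial>lebesgue_on {-pi..pi})"

definition fourier_sum :: "nat \<Rightarrow> (real \<Rightarrow> real) \<Rightarrow> real \<Rightarrow> real" where
  "fourier_sum m f x = fcos f 0 / 2 + (\<Sum>k=1..m. fcos f k * cos (real k * x) + fsin f k * sin (real k * x))"

definition eps_C :: "nat \<Rightarrow> (real \<Rightarrow> real) set \<Rightarrow> ereal" where
  "eps_C n N = (SUP f\<in>N. cnorm (\<lambda>x. f x - fourier_sum (n - 1) f x))"

definition eps_L :: "ereal \<Rightarrow> nat \<Rightarrow> (real \<Rightarrow> real) set \<Rightarrow> ereal" where
  "eps_L p n N = (SUP f\<in>N. lpnorm p (\<lambda>x. f x - fourier_sum (n - 1) f x))"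

end

theory Submission
  imports Defs
begin

text \<open>
  For \<open>r \<ge> n + 1\<close> the Fourier remainder is dominated by its first harmonic:
  \<open>f x - S\<^sub>n\<^sub>-\<^sub>1 f x\<close> is \<open>n\<^sup>-\<^sup>r / \<pi>\<close> times the integral of \<open>cos (n (x - t) - \<beta>\<^sub>n \<pi> / 2) * \<phi> t\<close>, up to an
  error at most a constant times \<open>(n + 1)\<^sup>-\<^sup>r\<close>, since Bernoulli's inequality gives
  \<open>((n + 1) / (n + 1 + j))\<^sup>r \<le> 4 / (j + 2)\<^sup>2\<close>.
  In the uniform norm the main term is at most the dual norm of the cosine by Young's inequality, and
  this is attained, or approximated for \<open>p = 1\<close>, by \<open>\<phi> t = h (sin (n t))\<close> with \<open>h\<close> odd, which has mean
  zero. In the \<open>L\<^sub>p\<close> norm with \<open>\<phi>\<close> in the unit ball of \<open>L\<^sub>1\<close> the main term is a cosine of amplitude at most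
  \<open>n\<^sup>-\<^sup>r / \<pi>\<close>, and amplitudes arbitrarily close to this value occur.
\<close>

section \<open>Integrals over a period\<close>

abbreviation Leb2pi :: "real measure" where "Leb2pi \<equiv> lebesgue_on {-pi..pi}"

lemma finite_measure_Leb2pi: "finite_measure Leb2pi"
  by (intro finite_measureI) (simp add: emeasure_restrict_space)

interpretation Leb2pi: finite_measure Leb2pi
  by (rule finite_measure_Leb2pi)

lemma borel_measurable_Leb2pi: "g \<in> borel_measurable borel \<Longrightarrow> g \<in> borel_measurable Leb2pi"
  by (rule measurable_restrict_space1) (simp add: measurable_completion)

lemma integrable_Leb2pi_bounded:
  fixes g :: "real \<Rightarrow> real"
  assumes "g \<in> borel_measurable borel" "\<And>t. \<bar>g t\<bar> \<le> B"
  shows "integrable Leb2pi g"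
  using assms by (intro Leb2pi.integrable_const_bound[where B=B] borel_measurable_Leb2pi) auto

text \<open>Bounded Borel integrands are integrable, so the Lebesgue integral agrees with the gauge
  integral, for which reflection of an interval is available.\<close>

lemma integral_Leb2pi_reflect:
  fixes g :: "real \<Rightarrow> real"
  assumes "g \<in> borel_measurable borel" "\<And>t. \<bar>g t\<bar> \<le> B"
  shows "(\<integral>t. g (- t) \<partial>Leb2pi) = (\<integral>t. g t \<partial>Leb2pi)"
proof -
  have "integrable Leb2pi g" "integrable Leb2pi (\<lambda>t. g (- t))"
    using assms by (auto intro!: integrable_Leb2pi_bounded[where B=B])
  then show ?thesis
    using integral_reflect_real[of pi "-pi" g] by (simp add: lebesgue_integral_eq_integral)
qed

lemma integral_Leb2pi_odd:
  fixes g :: "real \<Rightarrow> real"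
  assumes "g \<in> borel_measurable borel" "\<And>t. \<bar>g t\<bar> \<le> B" "\<And>t. g (- t) = - g t"
  shows "(\<integral>t. g t \<partial>Leb2pi) = 0"
  using integral_Leb2pi_reflect[OF assms(1,2)] assms(3) by simp

text \<open>The antiderivative \<open>G\<close> gains the same amount \<open>I\<close> over every
  period, so the \<open>n\<close> periods swept by the substitution contribute \<open>n * I\<close>,
  and the factor \<open>1 / n\<close> cancels. The phase drops out because an increment over whole
  periods does not depend on its starting point. This reduces the norms of dilated and shifted
  cosines to those of \<open>cos\<close>.\<close>

lemma integral_Leb2pi_dilate:
  fixes g :: "real \<Rightarrow> real" and n :: nat
  assumes cont: "continuous_on UNIV g" and per: "\<And>t. g (t + 2 * pi) = g t" and n: "n \<ge> 1"
  shows "(\<integral>t. g (real n * t + b) \<partial>Leb2pi) = (\<integral>t. g t \<partial>Leb2pi)"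
proof -
  \<comment> \<open>The antiderivative is taken on the whole line because the substitution maps the
    period onto an interval of length \<open>2 * pi * n\<close> around \<open>b\<close>.\<close>
  obtain G where G: "\<And>x. (G has_vector_derivative g x) (at x)"
    using einterval_antiderivative[of "-\<infinity>" "\<infinity>" g] cont
    by (auto simp: continuous_on_eq_continuous_at)
  have G': "(G has_real_derivative g x) (at x)" for x
    using G by (simp add: has_real_derivative_iff_has_vector_derivative)
  have dil: "(\<integral>t. g (real m * t + c) \<partial>Leb2pi) = (G (c + real m * pi) - G (c - real m * pi)) / real m"
    if m: "m \<ge> 1" for m c
  proof -
    have "continuous_on {-pi..pi} (\<lambda>t. g (real m * t + c))"
      by (intro continuous_on_compose2[OF cont] continuous_intros) auto
    then have eq: "(\<integral>t. g (real m * t + c) \<partial>Leb2pi) = integral {-pi..pi} (\<lambda>t. g (real m * t + c))"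
      by (intro lebesgue_integral_eq_integral continuous_imp_integrable_real) auto
    have "((\<lambda>t. g (real m * t + c)) has_integral
        (G (real m * pi + c) / real m - G (real m * (-pi) + c) / real m)) {-pi..pi}"
    proof (rule fundamental_theorem_of_calculus)
      fix x assume "x \<in> {-pi..pi}"
      have "((\<lambda>t. G (real m * t + c) / real m) has_real_derivative g (real m * x + c)) (at x)"
        using m by (auto intro!: derivative_eq_intros DERIV_chain2[OF G'])
      then show "((\<lambda>t. G (real m * t + c) / real m) has_vector_derivative g (real m * x + c)) (at x within {-pi..pi})"
        by (simp add: has_real_derivative_iff_has_vector_derivative has_vector_derivative_at_within)
    qed auto
    then have "integral {-pi..pi} (\<lambda>t. g (real m * t + c)) = (G (real m * pi + c) / real m - G (real m * (-pi) + c) / real m)"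
      by (rule integral_unique)
    with eq show ?thesis by (simp add: algebra_simps diff_divide_distrib)
  qed
  define I where "I = G pi - G (- pi)"
  have shift: "G (x + 2 * pi) = G x + I" for x
  proof -
    have "((\<lambda>x. G (x + 2 * pi) - G x) has_real_derivative 0) (at x)" for x
      using DERIV_shift[of G "g x" x "2*pi"] G'[of "x + 2*pi"] per[of x] G'[of x]
      by (auto intro!: derivative_eq_intros)
    then have "G (x + 2 * pi) - G x = G (-pi + 2 * pi) - G (-pi)"
      using DERIV_const_ratio_const DERIV_isconst_all by blast
    then show ?thesis by (simp add: I_def)
  qed
  have "G (x + real m * (2 * pi)) = G x + real m * I" for x m
  proof (induction m)
    case (Suc m)
    then show ?case using shift[of "x + real m * (2 * pi)"] by (simp add: algebra_simps)
  qed simp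
  from this[of "b - real n * pi" n] have "G (b + real n * pi) - G (b - real n * pi) = real n * I"
    by (simp add: algebra_simps)
  with dil[OF n, of b] dil[of 1 0] n show ?thesis
    by (simp add: I_def)
qed

section \<open>Convexity and Bernoulli inequalities for real powers\<close>

lemma powr_convex_nonneg:
  fixes x y a :: real
  assumes "p \<ge> 1" "x \<ge> 0" "y \<ge> 0" "0 \<le> a" "a \<le> 1"
  shows "(a * x + (1 - a) * y) powr p \<le> a * x powr p + (1 - a) * y powr p"
proof -
  \<comment> \<open>When \<open>x = 0\<close> or \<open>y = 0\<close> the claim reduces to this
    inequality, which holds since \<open>c powr p \<le> c\<close> on the unit interval; at positive
    arguments convexity of the power function applies.\<close>
  have *: "(c * z) powr p \<le> c * z powr p" if "0 \<le> c" "c \<le> 1" "0 \<le> z" for c z :: real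
  proof -
    have "c powr p \<le> c powr 1" using that assms(1) powr_mono'[of 1 p c] by auto
    then show ?thesis using that by (simp add: powr_mult mult_right_mono)
  qed
  show ?thesis
  proof (cases "x = 0 \<or> y = 0")
    case True
    then show ?thesis using *[of a x] *[of "1 - a" y] assms by auto
  next
    case False
    then show ?thesis
      using convex_onD[OF powr_convex[OF assms(1)], of "1 - a" x y] assms by (simp add: algebra_simps)
  qed
qed

text \<open>Weighted arithmetic-geometric mean inequality for \<open>1 + y * x\<close> and
  \<open>1\<close> with weights \<open>1 / y\<close> and \<open>1 - 1 / y\<close>, raised to the
  power \<open>y\<close>; this covers real exponents.\<close>

lemma powr_Bernoulli:
  fixes x y :: real
  assumes "x \<ge> 0" "y \<ge> 1"
  shows "1 + y * x \<le> (1 + x) powr y"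
proof -
  have "(1 + y * x) powr (1 / y) * 1 powr (1 - 1 / y) \<le> 1 / y * (1 + y * x) + (1 - 1 / y) * 1"
    using assms by (intro Youngs_inequality_0) (auto intro!: add_pos_nonneg)
  also have "\<dots> = 1 + x"
    using assms by (simp add: field_simps)
  finally have "((1 + y * x) powr (1 / y)) powr y \<le> (1 + x) powr y"
    using assms by (intro powr_mono2) auto
  then show ?thesis
    using assms by (simp add: powr_powr)
qed

section \<open>The Lebesgue norms of bounded functions and of the cosine\<close>

lemma integrable_Leb2pi_powr:
  fixes g :: "real \<Rightarrow> real"
  assumes "g \<in> borel_measurable borel" "\<And>t. \<bar>g t\<bar> \<le> B" "0 \<le> P"
  shows "integrable Leb2pi (\<lambda>t. \<bar>g t\<bar> powr P)"
  using assms by (intro integrable_Leb2pi_bounded[where B="B powr P"]) (auto intro!: powr_mono2)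

lemma lpnorm_ereal:
  fixes g :: "real \<Rightarrow> real"
  assumes "g \<in> borel_measurable borel" "\<And>t. \<bar>g t\<bar> \<le> B" "0 \<le> P"
  shows "lpnorm (ereal P) g = ereal ((\<integral>t. \<bar>g t\<bar> powr P \<partial>Leb2pi) powr (1 / P))"
  using integrable_Leb2pi_powr[OF assms] by (simp add: lpnorm_def)

lemma lpnorm_cmult:
  assumes g: "g \<in> borel_measurable borel" "\<And>t. \<bar>g t\<bar> \<le> B" and p: "1 \<le> p"
  shows "lpnorm p (\<lambda>t. c * g t) = ereal \<bar>c\<bar> * lpnorm p g"
proof (cases p)
  case (real P)
  with p have P: "P \<ge> 1" by simp
  have "\<bar>c * g t\<bar> \<le> \<bar>c\<bar> * B" for t
    using g(2)[of t] by (simp add: abs_mult mult_left_mono)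
  then have "lpnorm (ereal P) (\<lambda>t. c * g t) = ereal ((\<integral>t. \<bar>c * g t\<bar> powr P \<partial>Leb2pi) powr (1 / P))"
    using g P by (intro lpnorm_ereal) auto
  also have "(\<lambda>t. \<bar>c * g t\<bar> powr P) = (\<lambda>t. \<bar>c\<bar> powr P * \<bar>g t\<bar> powr P)"
    by (simp add: abs_mult powr_mult)
  also have "(\<integral>t. \<bar>c\<bar> powr P * \<bar>g t\<bar> powr P \<partial>Leb2pi) powr (1 / P)
      = \<bar>c\<bar> * (\<integral>t. \<bar>g t\<bar> powr P \<partial>Leb2pi) powr (1 / P)"
    using P by (simp add: powr_mult powr_powr)
  finally show ?thesis
    using lpnorm_ereal[OF g, of P] P real by simp
next
  case PInf
  \<comment> \<open>A positive factor can be pulled out of the essential supremum; the factor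
    \<open>0\<close> is treated apart, and there the essential supremum of a constant is that
    constant only because the measure is nonzero.\<close>
  have "emeasure Leb2pi (space Leb2pi) \<noteq> 0"
    by (simp add: emeasure_restrict_space)
  then have "esssup Leb2pi (\<lambda>t. 0 :: ereal) = 0"
    by (rule esssup_const)
  then show ?thesis
    using PInf esssup_cmult[of "\<bar>c\<bar>" Leb2pi "\<lambda>t. ereal \<bar>g t\<bar>"]
    by (cases "c = 0") (auto simp: lpnorm_def abs_mult simp flip: zero_ereal_def)
qed (use p in auto)

text \<open>A nonnegative continuous function that is positive at a peak of the cosine has positive
  integral. This serves twice: to show that the essential supremum of the cosine is
  \<open>1\<close>, and to normalise the near-extremal functions for \<open>p = 1\<close>.\<close>

lemma integral_cos_peak_pos:
  assumes "c < 1" "n \<ge> 1"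
  shows "0 < (\<integral>t. max 0 (\<bar>cos (real n * t + b)\<bar> - c) \<partial>Leb2pi)"
proof -
  define g where "g = (\<lambda>t::real. max 0 (\<bar>cos t\<bar> - c))"
  have cont: "continuous_on A g" for A
    unfolding g_def by (intro continuous_intros)
  have "(\<integral>t. g (real n * t + b) \<partial>Leb2pi) = (\<integral>t. g t \<partial>Leb2pi)"
    by (rule integral_Leb2pi_dilate[OF cont _ assms(2)]) (simp add: g_def)
  moreover have "(\<integral>t. g t \<partial>Leb2pi) \<noteq> 0"
    using assms(1) by (subst integralL_eq_0_iff[OF cont]) (auto simp: g_def intro!: bexI[of _ 0])
  moreover have "(\<integral>t. g t \<partial>Leb2pi) \<ge> 0"
    by (rule integral_nonneg_AE) (simp add: g_def)
  ultimately show ?thesis unfolding g_def by linarith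
qed

text \<open>Were the essential supremum below some \<open>c < 1\<close>, the part of the peaks above
  \<open>c\<close> would vanish almost everywhere, against the positivity of its integral.\<close>

lemma lpnorm_infinity_cos_dilate:
  assumes "n \<ge> 1"
  shows "lpnorm \<infinity> (\<lambda>t. cos (real n * t + b)) = 1"
proof -
  let ?g = "\<lambda>t. ereal \<bar>cos (real n * t + b)\<bar>"
  have [measurable]: "?g \<in> borel_measurable Leb2pi"
    by (intro borel_measurable_Leb2pi) measurable
  have "esssup Leb2pi ?g \<le> 1"
    by (rule esssup_I) (auto simp: one_ereal_def)
  moreover have "1 \<le> esssup Leb2pi ?g"
  proof (rule ccontr)
    assume "\<not> 1 \<le> esssup Leb2pi ?g"
    then have "esssup Leb2pi ?g < ereal 1"
      by (simp add: not_le flip: one_ereal_def)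
    then obtain c where c: "esssup Leb2pi ?g < ereal c" "c < 1"
      using ereal_dense2[of "esssup Leb2pi ?g" "ereal 1"] by auto
    have "AE t in Leb2pi. ?g t \<le> esssup Leb2pi ?g"
      by (rule esssup_AE)
    then have "AE t in Leb2pi. max 0 (\<bar>cos (real n * t + b)\<bar> - c) = 0"
    proof eventually_elim
      case (elim t)
      then have "?g t < ereal c" using c(1) by order
      then show ?case by simp
    qed
    then have "(\<integral>t. max 0 (\<bar>cos (real n * t + b)\<bar> - c) \<partial>Leb2pi) = 0"
      by (rule integral_eq_zero_AE)
    with integral_cos_peak_pos[OF c(2) assms, of b] show False by simp
  qed
  ultimately show ?thesis by (simp add: lpnorm_def)
qed

lemma integral_cos_powr_dilate:
  assumes "n \<ge> 1" "P \<ge> 1"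
  shows "(\<integral>t. \<bar>cos (real n * t + b)\<bar> powr P \<partial>Leb2pi) = (\<integral>t. \<bar>cos t\<bar> powr P \<partial>Leb2pi)"
proof -
  have "continuous_on UNIV (\<lambda>t::real. \<bar>cos t\<bar> powr P)"
    using assms by (intro continuous_on_powr' continuous_intros) auto
  then show ?thesis
    using integral_Leb2pi_dilate[of "\<lambda>t. \<bar>cos t\<bar> powr P" n b] assms by simp
qed

lemma lpnorm_cos_dilate:
  assumes "1 \<le> p" "n \<ge> 1"
  shows "lpnorm p (\<lambda>t. cos (real n * t + b)) = lpnorm p cos"
proof (cases p)
  case (real P)
  then show ?thesis
    using assms integral_cos_powr_dilate[of n P b]
    by (simp add: lpnorm_ereal[where B=1])
next
  case PInf
  then show ?thesis
    using lpnorm_infinity_cos_dilate[OF assms(2)] lpnorm_infinity_cos_dilate[of 1 0] by simp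
qed (use assms in auto)

lemma integral_cos_powr_pos:
  assumes "P \<ge> 1"
  shows "0 < (\<integral>t. \<bar>cos t\<bar> powr P \<partial>Leb2pi)"
proof -
  have "continuous_on {-pi..pi} (\<lambda>t::real. \<bar>cos t\<bar> powr P)"
    using assms by (intro continuous_on_powr' continuous_intros) auto
  then have "(\<integral>t. \<bar>cos t\<bar> powr P \<partial>Leb2pi) \<noteq> 0"
    by (subst integralL_eq_0_iff) (auto intro!: bexI[of _ 0])
  moreover have "(\<integral>t. \<bar>cos t\<bar> powr P \<partial>Leb2pi) \<ge> 0"
    by (rule integral_nonneg_AE) simp
  ultimately show ?thesis by linarith
qed

lemma lpnorm_cos_real:
  assumes "1 \<le> p"
  obtains D where "lpnorm p cos = ereal D" "0 \<le> D"
proof (cases p)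
  case (real P)
  with assms that[of "(\<integral>t. \<bar>cos t\<bar> powr P \<partial>Leb2pi) powr (1 / P)"] show ?thesis
    by (simp add: lpnorm_ereal[where B=1])
next
  case PInf
  then show ?thesis
    using lpnorm_infinity_cos_dilate[of 1 0] that[of 1] by (simp add: one_ereal_def)
qed (use assms in auto)

section \<open>Stability of the norm under small uniform perturbations\<close>

lemma Minkowski_powr:
  fixes u v :: "real \<Rightarrow> real"
  assumes "integrable M (\<lambda>t. \<bar>u t\<bar> powr P)" "integrable M (\<lambda>t. \<bar>v t\<bar> powr P)"
    and "(\<integral>t. \<bar>u t\<bar> powr P \<partial>M) \<le> a powr P" "(\<integral>t. \<bar>v t\<bar> powr P \<partial>M) \<le> b powr P"
    and P: "P \<ge> 1" and ab: "0 < a" "0 < b"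
  shows "(\<integral>t. \<bar>u t + v t\<bar> powr P \<partial>M) \<le> (a + b) powr P"
proof -
  \<comment> \<open>With this weight \<open>\<bar>u\<bar> + \<bar>v\<bar>\<close> is
    \<open>a + b\<close> times a convex combination of the normalised
    \<open>\<bar>u\<bar> / a\<close> and \<open>\<bar>v\<bar> / b\<close>, so convexity of the power
    applies pointwise before integrating. Positive bounds \<open>a\<close>, \<open>b\<close> stand
    in for the norms so that division is always allowed.\<close>
  define s where "s = a / (a + b)"
  have s: "0 \<le> s" "s \<le> 1" "1 - s = b / (a + b)"
    using ab by (auto simp: s_def field_simps)
  let ?h = "\<lambda>t. (a + b) powr P * (s / a powr P * \<bar>u t\<bar> powr P + (1 - s) / b powr P * \<bar>v t\<bar> powr P)"
  have pt: "\<bar>u t + v t\<bar> powr P \<le> ?h t" for t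
  proof -
    have "\<bar>u t + v t\<bar> powr P \<le> (\<bar>u t\<bar> + \<bar>v t\<bar>) powr P"
      using P by (intro powr_mono2) auto
    also have "\<bar>u t\<bar> + \<bar>v t\<bar> = (a + b) * (s * (\<bar>u t\<bar> / a) + (1 - s) * (\<bar>v t\<bar> / b))"
    proof -
      have "(a + b) * s = a" "(a + b) * (1 - s) = b"
        using ab s by (auto simp: s_def)
      then have "(a + b) * (s * (\<bar>u t\<bar> / a)) = \<bar>u t\<bar>" "(a + b) * ((1 - s) * (\<bar>v t\<bar> / b)) = \<bar>v t\<bar>"
        using ab by (simp_all flip: mult.assoc)
      then show ?thesis by (simp only: distrib_left)
    qed
    also have "\<dots> powr P = (a + b) powr P * (s * (\<bar>u t\<bar> / a) + (1 - s) * (\<bar>v t\<bar> / b)) powr P"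
      using ab s by (intro powr_mult)
    also have "\<dots> \<le> (a + b) powr P * (s * (\<bar>u t\<bar> / a) powr P + (1 - s) * (\<bar>v t\<bar> / b) powr P)"
      using ab s P by (intro mult_left_mono powr_convex_nonneg) auto
    also have "\<dots> = ?h t"
      using ab by (simp add: powr_divide)
    finally show ?thesis .
  qed
  have "(\<integral>t. \<bar>u t + v t\<bar> powr P \<partial>M) \<le> (\<integral>t. ?h t \<partial>M)"
    using assms(1,2) pt ab s
    by (intro integral_mono_AE') (auto intro!: AE_I2 mult_nonneg_nonneg add_nonneg_nonneg divide_nonneg_nonneg)
  also have "\<dots> = (a + b) powr P * (s / a powr P * (\<integral>t. \<bar>u t\<bar> powr P \<partial>M)
      + (1 - s) / b powr P * (\<integral>t. \<bar>v t\<bar> powr P \<partial>M))"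
    using assms(1,2) by simp
  also have "\<dots> \<le> (a + b) powr P * (s / a powr P * a powr P + (1 - s) / b powr P * b powr P)"
    using assms(3,4) s(1,2) by (intro mult_left_mono add_mono) auto
  also have "\<dots> = (a + b) powr P"
    using ab by simp
  finally show ?thesis .
qed

text \<open>A function bounded by \<open>\<rho>\<close> has norm at most
  \<open>(2 * pi) powr (1 / P) * \<rho>\<close>, hence at most \<open>2 * pi * \<rho>\<close> for
  every exponent. The cruder factor is what keeps the final constant independent of
  \<open>p\<close>.\<close>

lemma lpnorm_add_bounded:
  assumes u: "u \<in> borel_measurable borel" "\<And>t. \<bar>u t\<bar> \<le> B"
    and v: "v \<in> borel_measurable borel" "\<And>t. \<bar>v t\<bar> \<le> \<rho>" and \<rho>: "0 < \<rho>" and p: "1 \<le> p"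
  shows "lpnorm p (\<lambda>t. u t + v t) \<le> lpnorm p u + ereal (2 * pi * \<rho>)"
proof (cases p)
  case (real P)
  with p have P: "P \<ge> 1" by simp
  have uv: "\<bar>u t + v t\<bar> \<le> B + \<rho>" for t
    using u(2)[of t] v(2)[of t] by linarith
  let ?I = "\<lambda>w. \<integral>t. \<bar>w t\<bar> powr P \<partial>Leb2pi"
  have nn: "?I w \<ge> 0" for w :: "real \<Rightarrow> real"
    by (rule integral_nonneg_AE) simp
  \<comment> \<open>The slack \<open>e\<close> keeps the bound for \<open>u\<close> positive, as
    Minkowski's inequality above requires, even if the norm of \<open>u\<close> is zero.\<close>
  have "?I (\<lambda>t. u t + v t) powr (1 / P) \<le> ?I u powr (1 / P) + 2 * pi * \<rho> + e" if e: "e > 0" for e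
  proof -
    have "?I u = (?I u powr (1 / P)) powr P"
      using P nn by (simp add: powr_powr)
    also have "\<dots> \<le> (?I u powr (1 / P) + e) powr P"
      using P e by (intro powr_mono2) auto
    finally have Iu: "?I u \<le> (?I u powr (1 / P) + e) powr P" .
    have "?I v \<le> (\<integral>t. \<rho> powr P \<partial>Leb2pi)"
      using v P by (intro integral_mono integrable_Leb2pi_powr) (auto intro!: powr_mono2)
    also have "\<dots> = 2 * pi * \<rho> powr P"
      by (simp add: measure_restrict_space)
    also have "\<dots> \<le> (2 * pi) powr P * \<rho> powr P"
      using powr_mono[of 1 P "2 * pi"] P pi_gt3 by (intro mult_right_mono) auto
    also have "\<dots> = (2 * pi * \<rho>) powr P"
      using \<rho> by (simp add: powr_mult)
    finally have Iv: "?I v \<le> (2 * pi * \<rho>) powr P" .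
    have "?I (\<lambda>t. u t + v t) \<le> (?I u powr (1 / P) + e + 2 * pi * \<rho>) powr P"
      using Iu Iv P \<rho> e u v by (intro Minkowski_powr integrable_Leb2pi_powr) (auto intro: add_nonneg_pos)
    then have "?I (\<lambda>t. u t + v t) powr (1 / P) \<le> ((?I u powr (1 / P) + e + 2 * pi * \<rho>) powr P) powr (1 / P)"
      using P nn by (intro powr_mono2) auto
    also have "\<dots> = ?I u powr (1 / P) + e + 2 * pi * \<rho>"
      using P e \<rho> by (simp add: powr_powr)
    finally show ?thesis by simp
  qed
  then have "?I (\<lambda>t. u t + v t) powr (1 / P) \<le> ?I u powr (1 / P) + 2 * pi * \<rho>"
    by (rule field_le_epsilon)
  then show ?thesis
    using real P lpnorm_ereal[where g=u and P=P, OF u]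
      lpnorm_ereal[where g="\<lambda>t. u t + v t" and P=P, OF _ uv] u v by simp
next
  case PInf
  have [measurable]: "u \<in> borel_measurable Leb2pi" "v \<in> borel_measurable Leb2pi"
    using u v by (auto intro: borel_measurable_Leb2pi)
  have "esssup Leb2pi (\<lambda>t. ereal \<bar>u t + v t\<bar>) \<le> esssup Leb2pi (\<lambda>t. ereal \<bar>u t\<bar> + ereal \<bar>v t\<bar>)"
    by (rule esssup_mono) auto
  also have "\<dots> \<le> esssup Leb2pi (\<lambda>t. ereal \<bar>u t\<bar>) + esssup Leb2pi (\<lambda>t. ereal \<bar>v t\<bar>)"
    by (rule esssup_add)
  also have "esssup Leb2pi (\<lambda>t. ereal \<bar>v t\<bar>) \<le> ereal \<rho>"
    by (rule esssup_I) (auto simp: v)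
  also have "ereal \<rho> \<le> ereal (2 * pi * \<rho>)"
    using \<rho> pi_gt3 by (simp add: mult_le_cancel_right1)
  finally show ?thesis
    using PInf by (simp add: lpnorm_def add_left_mono)
qed (use p in auto)

section \<open>Fourier sums of absolutely convergent trigonometric series\<close>

lemma integral_cos_int:
  fixes m :: int
  assumes "m \<noteq> 0"
  shows "(\<integral>t. cos (of_int m * t) \<partial>Leb2pi) = 0"
proof -
  have "(\<integral>t. cos (real k * t + b) \<partial>Leb2pi) = (\<integral>t. cos t \<partial>Leb2pi)" if "k \<ge> 1" for k b
    by (rule integral_Leb2pi_dilate[OF _ _ that]) (auto intro: continuous_intros)
  \<comment> \<open>Dilation reduces to frequency \<open>1\<close>, and the shift by
    \<open>pi\<close> changes the sign of the cosine, so its integral equals its own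
    negative.\<close>
  from this[of "nat \<bar>m\<bar>" 0] this[of 1 pi] assms
  have "(\<integral>t. cos (real_of_int \<bar>m\<bar> * t) \<partial>Leb2pi) = 0" by simp
  moreover have "cos (real_of_int \<bar>m\<bar> * t) = cos (of_int m * t)" for t
    by (cases "m \<ge> 0") auto
  ultimately show ?thesis by simp
qed

lemma integral_cos_nat: "(\<integral>t. cos (real j * t) \<partial>Leb2pi) = (if j = 0 then 2 * pi else 0)"
  using integral_cos_int[of "int j"] by (auto simp: measure_restrict_space)

lemma integral_cos_cos:
  assumes "k \<ge> 1"
  shows "(\<integral>t. cos (real k * t) * cos (real j * t) \<partial>Leb2pi) = (if j = k then pi else 0)"
proof -
  have int: "integrable Leb2pi (\<lambda>t. cos (c * t))" for c
    by (rule integrable_Leb2pi_bounded[where B=1]) auto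
  have "(\<integral>t. cos (real k * t) * cos (real j * t) \<partial>Leb2pi)
      = (\<integral>t. cos (of_int (int k - int j) * t) / 2 + cos (of_int (int k + int j) * t) / 2 \<partial>Leb2pi)"
    by (intro Bochner_Integration.integral_cong) (auto simp: cos_times_cos left_diff_distrib distrib_right add_divide_distrib)
  also have "\<dots> = (\<integral>t. cos (of_int (int k - int j) * t) \<partial>Leb2pi) / 2
      + (\<integral>t. cos (of_int (int k + int j) * t) \<partial>Leb2pi) / 2"
    using int by simp
  also have "(\<integral>t. cos (of_int (int k + int j) * t) \<partial>Leb2pi) = 0"
    using assms by (intro integral_cos_int) auto
  also have "(\<integral>t. cos (of_int (int k - int j) * t) \<partial>Leb2pi) = (if j = k then 2 * pi else 0)"
    using integral_cos_int[of "int k - int j"] by (auto simp: measure_restrict_space)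
  finally show ?thesis by (auto split: if_splits)
qed

lemma integral_sin_sin:
  assumes "k \<ge> 1"
  shows "(\<integral>t. sin (real k * t) * sin (real j * t) \<partial>Leb2pi) = (if j = k then pi else 0)"
proof -
  have int: "integrable Leb2pi (\<lambda>t. cos (c * t))" for c
    by (rule integrable_Leb2pi_bounded[where B=1]) auto
  have "(\<integral>t. sin (real k * t) * sin (real j * t) \<partial>Leb2pi)
      = (\<integral>t. cos (of_int (int k - int j) * t) / 2 - cos (of_int (int k + int j) * t) / 2 \<partial>Leb2pi)"
    by (intro Bochner_Integration.integral_cong) (auto simp: sin_times_sin left_diff_distrib distrib_right diff_divide_distrib)
  also have "\<dots> = (\<integral>t. cos (of_int (int k - int j) * t) \<partial>Leb2pi) / 2
      - (\<integral>t. cos (of_int (int k + int j) * t) \<partial>Leb2pi) / 2"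
    using int by simp
  also have "(\<integral>t. cos (of_int (int k + int j) * t) \<partial>Leb2pi) = 0"
    using assms by (intro integral_cos_int) auto
  also have "(\<integral>t. cos (of_int (int k - int j) * t) \<partial>Leb2pi) = (if j = k then 2 * pi else 0)"
    using integral_cos_int[of "int k - int j"] by (auto simp: measure_restrict_space)
  finally show ?thesis by (auto split: if_splits)
qed

lemma integral_sin_cos: "(\<integral>t. sin (c * t) * cos (d * t) \<partial>Leb2pi) = 0"
proof (rule integral_Leb2pi_odd[where B=1])
  fix t show "\<bar>sin (c * t) * cos (d * t)\<bar> \<le> 1"
    by (simp add: abs_mult mult_le_one)
qed auto

lemma integral_cos_sin: "(\<integral>t. cos (c * t) * sin (d * t) \<partial>Leb2pi) = 0"
  using integral_sin_cos[of d c] by (simp add: mult.commute)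

lemma integral_sin: "(\<integral>t. sin (c * t) \<partial>Leb2pi) = 0"
  using integral_sin_cos[of c 0] by simp

text \<open>Absolute summability of the coefficients dominates the series, so it may be integrated
  term by term against a bounded \<open>g\<close>. Taking \<open>g\<close> to be a cosine or a sine
  gives the Fourier coefficients.\<close>

lemma sums_integral_trig_series:
  fixes p q :: "nat \<Rightarrow> real"
  assumes sum: "summable (\<lambda>k. \<bar>p k\<bar>)" "summable (\<lambda>k. \<bar>q k\<bar>)"
    and f: "\<And>x. f x = A + (\<Sum>k. p k * cos (real (Suc k) * x) + q k * sin (real (Suc k) * x))"
    and g: "g \<in> borel_measurable borel" "\<And>t. \<bar>g t\<bar> \<le> 1"
  shows "(\<lambda>k. p k * (\<integral>t. cos (real (Suc k) * t) * g t \<partial>Leb2pi)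
        + q k * (\<integral>t. sin (real (Suc k) * t) * g t \<partial>Leb2pi))
      sums ((\<integral>t. f t * g t \<partial>Leb2pi) - A * (\<integral>t. g t \<partial>Leb2pi))"
proof -
  let ?u = "\<lambda>k t. (p k * cos (real (Suc k) * t) + q k * sin (real (Suc k) * t)) * g t"
  have bnd: "\<bar>p k * cos (real (Suc k) * t) + q k * sin (real (Suc k) * t)\<bar> \<le> \<bar>p k\<bar> + \<bar>q k\<bar>" for k t
    by (intro order_trans[OF abs_triangle_ineq] add_mono) (auto simp: abs_mult mult_left_le)
  have ubnd: "\<bar>?u k t\<bar> \<le> \<bar>p k\<bar> + \<bar>q k\<bar>" for k t
    using mult_mono[OF bnd[of k t] g(2)[of t]] by (simp add: abs_mult)
  have sum': "summable (\<lambda>k. \<bar>p k\<bar> + \<bar>q k\<bar>)"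
    using sum by (rule summable_add)
  have smb: "summable (\<lambda>k. p k * cos (real (Suc k) * t) + q k * sin (real (Suc k) * t))" for t
    by (rule summable_comparison_test'[OF sum']) (use bnd in auto)
  have int: "integrable Leb2pi (?u k)" for k
    using g ubnd by (intro integrable_Leb2pi_bounded[OF _ ubnd]) auto
  have absint: "(\<integral>t. norm (?u k t) \<partial>Leb2pi) \<le> 2 * pi * (\<bar>p k\<bar> + \<bar>q k\<bar>)" for k
  proof -
    have "(\<integral>t. norm (?u k t) \<partial>Leb2pi) \<le> (\<integral>t. \<bar>p k\<bar> + \<bar>q k\<bar> \<partial>Leb2pi)"
      using int[of k] ubnd by (intro integral_mono) auto
    then show ?thesis by (simp add: measure_restrict_space)
  qed
  have S: "summable (\<lambda>k. norm (?u k t))" for t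
    by (rule summable_comparison_test'[OF sum']) (use ubnd in auto)
  have S': "summable (\<lambda>k. \<integral>t. norm (?u k t) \<partial>Leb2pi)"
    by (rule summable_comparison_test'[OF summable_mult[OF sum', of "2 * pi"]]) (use absint in auto)
  have *: "(\<lambda>k. \<integral>t. ?u k t \<partial>Leb2pi) sums (\<integral>t. (\<Sum>k. ?u k t) \<partial>Leb2pi)"
    and intS: "integrable Leb2pi (\<lambda>t. \<Sum>k. ?u k t)"
    using sums_integral[OF int _ S'] integrable_suminf[OF int _ S'] S by auto
  have intg: "integrable Leb2pi g"
    using g by (intro integrable_Leb2pi_bounded) auto
  have "f t * g t = A * g t + (\<Sum>k. ?u k t)" for t
    using suminf_mult2[OF smb[of t], of "g t"] by (simp add: f algebra_simps)
  then have "(\<integral>t. f t * g t \<partial>Leb2pi) = A * (\<integral>t. g t \<partial>Leb2pi) + (\<integral>t. (\<Sum>k. ?u k t) \<partial>Leb2pi)"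
    using intS intg by simp
  moreover have "(\<integral>t. ?u k t \<partial>Leb2pi) = p k * (\<integral>t. cos (real (Suc k) * t) * g t \<partial>Leb2pi)
        + q k * (\<integral>t. sin (real (Suc k) * t) * g t \<partial>Leb2pi)" for k
  proof -
    have "\<bar>cos y * g t\<bar> \<le> 1" "\<bar>sin y * g t\<bar> \<le> 1" for y t
      using g(2)[of t] by (auto simp: abs_mult mult_le_one)
    then have "integrable Leb2pi (\<lambda>t. cos (real (Suc k) * t) * g t)"
      "integrable Leb2pi (\<lambda>t. sin (real (Suc k) * t) * g t)"
      using g by (auto intro!: integrable_Leb2pi_bounded[where B=1])
    then show ?thesis
      by (simp add: distrib_right mult.assoc del: of_nat_Suc)
  qed
  ultimately show ?thesis using * by simp
qed

text \<open>By orthogonality each Fourier coefficient picks out one term of the series. Since index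
  \<open>k\<close> carries the harmonic \<open>Suc k\<close>, the sum of order \<open>m\<close>
  consists of the indices below \<open>m\<close>.\<close>

lemma fourier_sum_trig_series:
  fixes p q :: "nat \<Rightarrow> real"
  assumes sum: "summable (\<lambda>k. \<bar>p k\<bar>)" "summable (\<lambda>k. \<bar>q k\<bar>)"
    and f: "\<And>x. f x = A + (\<Sum>k. p k * cos (real (Suc k) * x) + q k * sin (real (Suc k) * x))"
  shows "fourier_sum m f x = A + (\<Sum>k<m. p k * cos (real (Suc k) * x) + q k * sin (real (Suc k) * x))"
proof -
  have c: "(\<lambda>k. p k * (if j = Suc k then pi else 0))
      sums ((\<integral>t. f t * cos (real j * t) \<partial>Leb2pi) - A * (if j = 0 then 2 * pi else 0))" for j
    using sums_integral_trig_series[OF sum f, of "\<lambda>t. cos (real j * t)"]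
    by (simp add: integral_cos_cos integral_sin_cos integral_cos_nat del: of_nat_Suc)
  have s: "(\<lambda>k. q k * (if j = Suc k then pi else 0)) sums (\<integral>t. f t * sin (real j * t) \<partial>Leb2pi)" for j
    using sums_integral_trig_series[OF sum f, of "\<lambda>t. sin (real j * t)"]
    by (simp add: integral_sin_sin integral_cos_sin integral_sin del: of_nat_Suc)
  have single: "(\<lambda>k. w k * (if Suc j = Suc k then pi else 0)) sums (w j * pi)" for w :: "nat \<Rightarrow> real" and j
    using sums_If_finite_set[of "{j}" "\<lambda>k. w k * pi"] by (simp add: if_distrib eq_commute cong: if_cong)
  have "fcos f 0 = 2 * A"
    using sums_unique[OF c[of 0]] by (simp add: fcos_def)
  moreover have "fcos f (Suc j) = p j" for j
    using sums_unique2[OF c[of "Suc j"] single[of p j]] by (simp add: fcos_def)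
  moreover have "fsin f (Suc j) = q j" for j
    using sums_unique2[OF s[of "Suc j"] single[of q j]] by (simp add: fsin_def)
  moreover have "fourier_sum m f x = fcos f 0 / 2
      + (\<Sum>k<m. fcos f (Suc k) * cos (real (Suc k) * x) + fsin f (Suc k) * sin (real (Suc k) * x))"
    unfolding fourier_sum_def by (simp only: sum.atLeast1_atMost_eq One_nat_def)
  ultimately show ?thesis by simp
qed

section \<open>The first harmonic of the remainder\<close>

text \<open>Put \<open>x = j / (n + 1)\<close>; then \<open>r \<ge> n + 1\<close> gives
  \<open>r * x \<ge> j\<close>. Bernoulli is applied with exponent \<open>r / 2\<close> and then
  squared: the exponent \<open>r\<close> itself would give decay like \<open>1 / (1 + j)\<close>
  only, which is not summable.\<close>

lemma powr_tail_term:
  assumes "n \<ge> 1" "real n + 1 \<le> r"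
  shows "real (n + 1 + j) powr (-r) \<le> real (n + 1) powr (-r) * (4 / (real j + 2)\<^sup>2)"
proof -
  define x where "x = real j / real (n + 1)"
  have x: "x \<ge> 0" by (simp add: x_def)
  have "1 + real j / 2 \<le> 1 + r / 2 * x"
  proof -
    have "real j = real (n + 1) * x" by (simp add: x_def)
    also have "\<dots> \<le> r * x" using assms x by (intro mult_right_mono) auto
    finally show ?thesis by simp
  qed
  also have "\<dots> \<le> (1 + x) powr (r / 2)"
    using assms x by (intro powr_Bernoulli) auto
  finally have "(1 + real j / 2)\<^sup>2 \<le> ((1 + x) powr (r / 2))\<^sup>2"
    by (intro power_mono) auto
  also have "\<dots> = (1 + x) powr r"
    using x by (simp add: powr_power)
  finally have "(1 + real j / 2)\<^sup>2 \<le> (1 + x) powr r" .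
  then have "(1 + x) powr (-r) \<le> 1 / (1 + real j / 2)\<^sup>2"
    by (simp add: powr_minus_divide frac_le)
  also have "\<dots> = 4 / (real j + 2)\<^sup>2"
    by (simp add: field_simps power2_eq_square)
  finally have le: "(1 + x) powr (-r) \<le> 4 / (real j + 2)\<^sup>2" .
  have "real (n + 1 + j) = real (n + 1) * (1 + x)"
    by (simp add: x_def field_simps)
  then have "real (n + 1 + j) powr (-r) = real (n + 1) powr (-r) * (1 + x) powr (-r)"
    using x by (simp only: powr_mult)
  also have "\<dots> \<le> real (n + 1) powr (-r) * (4 / (real j + 2)\<^sup>2)"
    using le by (intro mult_left_mono) auto
  finally show ?thesis .
qed

lemma summable_inverse_squares_shift: "summable (\<lambda>j. 4 / (real j + 2)\<^sup>2)"
proof -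
  have "summable (\<lambda>j. 1 / real j ^ 2)"
    using inverse_power_summable[of 2, where 'a=real] by (simp add: inverse_eq_divide)
  then have "summable (\<lambda>j. 1 / real (j + 2) ^ 2)"
    by (rule summable_ignore_initial_segment)
  then show ?thesis
    using summable_mult[of "\<lambda>j. 1 / real (j + 2) ^ 2" 4] by (simp add: add.commute)
qed

lemma summable_powr_Suc:
  assumes "r > 1"
  shows "summable (\<lambda>k. real (Suc k) powr (-r))"
proof -
  have "summable (\<lambda>k. real k powr (-r))"
    using assms by (simp add: summable_real_powr_iff)
  then show ?thesis
    by (subst summable_Suc_iff)
qed

section \<open>Integral bounds for functions in the unit ball\<close>

lemma U0_ereal:
  assumes "\<phi> \<in> U0 (ereal P)" "P \<ge> 1"
  shows "integrable Leb2pi (\<lambda>t. \<bar>\<phi> t\<bar> powr P)" "(\<integral>t. \<bar>\<phi> t\<bar> powr P \<partial>Leb2pi) \<le> 1"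
proof -
  let ?I = "\<integral>t. \<bar>\<phi> t\<bar> powr P \<partial>Leb2pi"
  show "integrable Leb2pi (\<lambda>t. \<bar>\<phi> t\<bar> powr P)"
    using assms by (auto simp: U0_def in_Lp_def)
  then have "?I powr (1 / P) \<le> 1"
    using assms by (auto simp: U0_def lpnorm_def one_ereal_def)
  moreover have "1 < ?I powr (1 / P)" if "1 < ?I"
    using that assms(2) powr_less_mono2[of "1 / P" 1 ?I] by simp
  ultimately show "?I \<le> 1" by (meson not_le)
qed

lemma U0_infinity:
  assumes "\<phi> \<in> U0 \<infinity>"
  shows "AE t in Leb2pi. \<bar>\<phi> t\<bar> \<le> 1"
proof -
  let ?s = "esssup Leb2pi (\<lambda>t. ereal \<bar>\<phi> t\<bar>)"
  have "?s \<le> 1"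
    using assms by (simp add: U0_def lpnorm_def)
  moreover have "AE t in Leb2pi. ereal \<bar>\<phi> t\<bar> \<le> ?s"
    by (rule esssup_AE)
  ultimately have "AE t in Leb2pi. ereal \<bar>\<phi> t\<bar> \<le> 1"
    by (auto elim!: eventually_mono intro: order_trans simp del: ereal_less_eq)
  then show ?thesis by (simp add: one_ereal_def)
qed

lemma U0_measurable: "\<phi> \<in> U0 p \<Longrightarrow> \<phi> \<in> borel_measurable Leb2pi"
  by (auto simp: U0_def in_Lp_def intro: measurable_restrict_space1)

text \<open>Integrating \<open>\<bar>\<phi>\<bar> \<le> 1 + \<bar>\<phi>\<bar> powr P\<close> over
  the period bounds the \<open>L_1\<close> norm by the same number for all exponents, so one
  remainder estimate serves every \<open>p\<close>.\<close>

lemma U0_integrable: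
  assumes "\<phi> \<in> U0 p" "1 \<le> p"
  shows "integrable Leb2pi \<phi>" "(\<integral>t. \<bar>\<phi> t\<bar> \<partial>Leb2pi) \<le> 2 * pi + 1"
proof -
  note [measurable] = U0_measurable[OF assms(1)]
  have "integrable Leb2pi \<phi> \<and> (\<integral>t. \<bar>\<phi> t\<bar> \<partial>Leb2pi) \<le> 2 * pi + 1"
  proof (cases p)
    case (real P)
    with assms have P: "P \<ge> 1" and int: "integrable Leb2pi (\<lambda>t. \<bar>\<phi> t\<bar> powr P)"
      and le: "(\<integral>t. \<bar>\<phi> t\<bar> powr P \<partial>Leb2pi) \<le> 1"
      using U0_ereal[of \<phi> P] by auto
    have pt: "\<bar>\<phi> t\<bar> \<le> 1 + \<bar>\<phi> t\<bar> powr P" for t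
      using powr_mono[of 1 P "\<bar>\<phi> t\<bar>"] P by (cases "\<bar>\<phi> t\<bar> \<le> 1") (auto intro: add_increasing2)
    have int1: "integrable Leb2pi (\<lambda>t. 1 + \<bar>\<phi> t\<bar> powr P)"
      using int by auto
    then have "integrable Leb2pi \<phi>"
      by (rule Bochner_Integration.integrable_bound) (use pt in auto)
    moreover have "(\<integral>t. \<bar>\<phi> t\<bar> \<partial>Leb2pi) \<le> (\<integral>t. 1 + \<bar>\<phi> t\<bar> powr P \<partial>Leb2pi)"
      using int1 calculation pt by (intro integral_mono) auto
    ultimately show ?thesis
      using int le by (simp add: measure_restrict_space)
  next
    case PInf
    with assms have ae: "AE t in Leb2pi. \<bar>\<phi> t\<bar> \<le> 1"
      using U0_infinity by simp
    then have "integrable Leb2pi \<phi>"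
      by (intro Leb2pi.integrable_const_bound[where B=1]) auto
    moreover have "(\<integral>t. \<bar>\<phi> t\<bar> \<partial>Leb2pi) \<le> (\<integral>t. 1 \<partial>Leb2pi)"
      using calculation ae by (intro integral_mono_AE) auto
    ultimately show ?thesis
      by (simp add: measure_restrict_space)
  qed (use assms in auto)
  then show "integrable Leb2pi \<phi>" "(\<integral>t. \<bar>\<phi> t\<bar> \<partial>Leb2pi) \<le> 2 * pi + 1" by auto
qed

lemma integrable_Leb2pi_mult_bounded:
  fixes \<phi> g :: "real \<Rightarrow> real"
  assumes "integrable Leb2pi \<phi>" "g \<in> borel_measurable borel" "\<And>t. \<bar>g t\<bar> \<le> 1"
  shows "integrable Leb2pi (\<lambda>t. g t * \<phi> t)"
proof -
  have [measurable]: "g \<in> borel_measurable Leb2pi" "\<phi> \<in> borel_measurable Leb2pi"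
    using assms by (auto intro: borel_measurable_Leb2pi)
  show ?thesis
    using assms(1)
    by (rule Bochner_Integration.integrable_bound) (use assms(3) in \<open>auto simp: abs_mult mult_left_le_one_le\<close>)
qed

lemma abs_integral_mult_bounded:
  fixes \<phi> g :: "real \<Rightarrow> real"
  assumes "integrable Leb2pi \<phi>" "g \<in> borel_measurable borel" "\<And>t. \<bar>g t\<bar> \<le> 1"
  shows "\<bar>\<integral>t. g t * \<phi> t \<partial>Leb2pi\<bar> \<le> (\<integral>t. \<bar>\<phi> t\<bar> \<partial>Leb2pi)"
proof -
  have "\<bar>\<integral>t. g t * \<phi> t \<partial>Leb2pi\<bar> \<le> (\<integral>t. \<bar>g t * \<phi> t\<bar> \<partial>Leb2pi)"
    by (rule integral_abs_bound)
  also have "\<dots> \<le> (\<integral>t. \<bar>\<phi> t\<bar> \<partial>Leb2pi)"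
    using integrable_abs[OF integrable_Leb2pi_mult_bounded[OF assms]] assms
    by (intro integral_mono) (auto simp: abs_mult mult_left_le_one_le)
  finally show ?thesis .
qed

text \<open>Separates \<open>y\<close> from the integration variable: convolving
  \<open>\<phi>\<close> with a harmonic gives a harmonic whose coefficients are the integrals of
  \<open>\<phi>\<close> against cosine and sine.\<close>

lemma integral_cos_shift_expand:
  fixes \<phi> :: "real \<Rightarrow> real"
  assumes "integrable Leb2pi \<phi>"
  shows "(\<integral>t. cos (y - c * t) * \<phi> t \<partial>Leb2pi)
     = cos y * (\<integral>t. cos (c * t) * \<phi> t \<partial>Leb2pi) + sin y * (\<integral>t. sin (c * t) * \<phi> t \<partial>Leb2pi)"
proof -
  have "integrable Leb2pi (\<lambda>t. cos (c * t) * \<phi> t)" "integrable Leb2pi (\<lambda>t. sin (c * t) * \<phi> t)"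
    using assms by (auto intro!: integrable_Leb2pi_mult_bounded)
  moreover have "cos (y - c * t) * \<phi> t = cos y * (cos (c * t) * \<phi> t) + sin y * (sin (c * t) * \<phi> t)" for t
    by (simp add: cos_diff algebra_simps)
  ultimately show ?thesis by simp
qed

section \<open>Fourier expansion of the convolution and its remainder\<close>

lemma Psi_convolution_sums:
  fixes \<phi> :: "real \<Rightarrow> real"
  assumes \<phi>: "integrable Leb2pi \<phi>" and r: "r > 1"
  shows "(\<integral>t. Psi \<beta> r (x - t) * \<phi> t \<partial>Leb2pi)
    = (\<Sum>k. real (Suc k) powr (-r) * (\<integral>t. cos (real (Suc k) * x - \<beta> (Suc k) * pi / 2 - real (Suc k) * t) * \<phi> t \<partial>Leb2pi))"
proof -
  let ?c = "\<lambda>k t. cos (real (Suc k) * x - \<beta> (Suc k) * pi / 2 - real (Suc k) * t)"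
  let ?u = "\<lambda>k t. real (Suc k) powr (-r) * (?c k t * \<phi> t)"
  have int0: "integrable Leb2pi (\<lambda>t. ?c k t * \<phi> t)" for k
    using \<phi> by (rule integrable_Leb2pi_mult_bounded) auto
  then have int: "integrable Leb2pi (?u k)" for k
    by simp
  note sm = summable_powr_Suc[OF r]
  \<comment> \<open>This majorant is summable in \<open>k\<close> for \<open>r > 1\<close>, both
    pointwise and after integration, which justifies exchanging sum and integral.\<close>
  have ubnd: "norm (?u k t) \<le> real (Suc k) powr (-r) * \<bar>\<phi> t\<bar>" for k t
    by (auto simp: abs_mult intro!: mult_left_mono mult_left_le_one_le)
  have S: "summable (\<lambda>k. norm (?u k t))" for t
    by (rule summable_comparison_test'[OF summable_mult2[OF sm, of "\<bar>\<phi> t\<bar>"]]) (use ubnd in auto)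
  have absint: "(\<integral>t. norm (?u k t) \<partial>Leb2pi) \<le> real (Suc k) powr (-r) * (\<integral>t. \<bar>\<phi> t\<bar> \<partial>Leb2pi)" for k
  proof -
    have "(\<integral>t. norm (?u k t) \<partial>Leb2pi) \<le> (\<integral>t. real (Suc k) powr (-r) * \<bar>\<phi> t\<bar> \<partial>Leb2pi)"
      using int[of k] \<phi> ubnd by (intro integral_mono) (auto simp del: of_nat_Suc)
    then show ?thesis by simp
  qed
  have S': "summable (\<lambda>k. \<integral>t. norm (?u k t) \<partial>Leb2pi)"
    by (rule summable_comparison_test'[OF summable_mult2[OF sm, of "\<integral>t. \<bar>\<phi> t\<bar> \<partial>Leb2pi"]])
       (use absint in auto)
  have smP: "summable (\<lambda>k. real (Suc k) powr (-r) * cos (real (Suc k) * (x - t) - \<beta> (Suc k) * pi / 2))" for t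
    by (rule summable_comparison_test'[OF sm]) (auto simp: abs_mult intro!: mult_left_le)
  have "Psi \<beta> r (x - t) * \<phi> t = (\<Sum>k. ?u k t)" for t
    unfolding Psi_def using suminf_mult2[OF smP[of t], of "\<phi> t"]
    by (simp add: algebra_simps)
  then have "(\<integral>t. Psi \<beta> r (x - t) * \<phi> t \<partial>Leb2pi) = (\<Sum>k. \<integral>t. ?u k t \<partial>Leb2pi)"
    using integral_suminf[OF int _ S'] S by simp
  then show ?thesis by simp
qed

text \<open>Bounds the sum of \<open>(k / (n + 1)) powr (-r)\<close> over
  \<open>k \<ge> n + 1\<close>, uniformly in \<open>n \<ge> 1\<close> and
  \<open>r \<ge> n + 1\<close>.\<close>

definition tail_const :: real where
  "tail_const = (\<Sum>j. 4 / (real j + 2)\<^sup>2)"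

lemma tail_const_pos: "tail_const > 0"
  unfolding tail_const_def by (rule suminf_pos[OF summable_inverse_squares_shift]) simp

text \<open>The partial sum removes the harmonics below \<open>n\<close>, the harmonic
  \<open>n\<close> is kept as main term, and \<open>R\<close> collects those above. Only a bound
  \<open>N\<close> on the \<open>L_1\<close> norm of \<open>\<phi>\<close> enters. Measurability of
  \<open>R\<close> is recorded because the \<open>L_p\<close> estimates need it.\<close>

lemma Wclass_remainder:
  fixes \<phi> :: "real \<Rightarrow> real"
  assumes n: "n \<ge> 1" and r: "real n + 1 \<le> r" and \<phi>: "integrable Leb2pi \<phi>"
    and N: "(\<integral>t. \<bar>\<phi> t\<bar> \<partial>Leb2pi) \<le> N"
    and f: "\<And>x. f x = a0 / 2 + 1 / pi * (\<integral>t. Psi \<beta> r (x - t) * \<phi> t \<partial>Leb2pi)"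
  shows "\<exists>R\<in>borel_measurable borel. (\<forall>x. \<bar>R x\<bar> \<le> N / pi * tail_const * real (n + 1) powr (-r))
    \<and> (\<forall>x. f x - fourier_sum (n - 1) f x
      = real n powr (-r) / pi * (\<integral>t. cos (real n * x - \<beta> n * pi / 2 - real n * t) * \<phi> t \<partial>Leb2pi) + R x)"
proof -
  define H where "H k x = (\<integral>t. cos (real k * x - \<beta> k * pi / 2 - real k * t) * \<phi> t \<partial>Leb2pi)" for k x
  define a b where "a k = (\<integral>t. cos (real k * t) * \<phi> t \<partial>Leb2pi)" and "b k = (\<integral>t. sin (real k * t) * \<phi> t \<partial>Leb2pi)" for k
  define u where "u k x = real (Suc k) powr (-r) / pi * H (Suc k) x" for k x
  \<comment> \<open>\<open>p\<close> and \<open>q\<close> are the cosine and sine coefficients of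
    the harmonic \<open>Suc k\<close>, obtained by expanding the phase shifted by
    \<open>\<beta> (Suc k) * pi / 2\<close>.\<close>
  define p where "p k = real (Suc k) powr (-r) / pi
      * (a (Suc k) * cos (\<beta> (Suc k) * pi / 2) - b (Suc k) * sin (\<beta> (Suc k) * pi / 2))" for k
  define q where "q k = real (Suc k) powr (-r) / pi
      * (a (Suc k) * sin (\<beta> (Suc k) * pi / 2) + b (Suc k) * cos (\<beta> (Suc k) * pi / 2))" for k
  have H_exp: "H k x = cos (real k * x - \<beta> k * pi / 2) * a k + sin (real k * x - \<beta> k * pi / 2) * b k" for k x
    unfolding H_def a_def b_def by (rule integral_cos_shift_expand[OF \<phi>])
  have u_eq: "u k x = p k * cos (real (Suc k) * x) + q k * sin (real (Suc k) * x)" for k x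
    unfolding u_def H_exp p_def q_def cos_diff sin_diff by (simp add: field_simps del: of_nat_Suc)
  have HN: "\<bar>H k x\<bar> \<le> N" for k x
    unfolding H_def by (rule order_trans[OF abs_integral_mult_bounded[OF \<phi>] N]) auto
  have aN: "\<bar>a k\<bar> \<le> N" and bN: "\<bar>b k\<bar> \<le> N" for k
    unfolding a_def b_def by (rule order_trans[OF abs_integral_mult_bounded[OF \<phi>] N]; simp)+
  have N0: "N \<ge> 0" using aN[of 0] by linarith
  have r1: "r > 1" using n r by linarith
  have smN: "summable (\<lambda>k. real (Suc k) powr (-r) * (2 * N / pi))"
    using summable_mult2[OF summable_powr_Suc[OF r1]] .
  have bnd: "\<bar>s * (y * c + z * d)\<bar> \<le> s * (2 * N)" if "\<bar>y\<bar> \<le> N" "\<bar>z\<bar> \<le> N" "\<bar>c\<bar> \<le> 1" "\<bar>d\<bar> \<le> 1" "s \<ge> 0" for s y z c d :: real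
  proof -
    have "\<bar>y * c + z * d\<bar> \<le> \<bar>y\<bar> * \<bar>c\<bar> + \<bar>z\<bar> * \<bar>d\<bar>"
      by (metis abs_mult abs_triangle_ineq)
    also have "\<dots> \<le> N * 1 + N * 1"
      using that N0 by (intro add_mono mult_mono) auto
    finally show ?thesis using that by (simp add: abs_mult mult_left_mono)
  qed
  have "\<bar>p k\<bar> \<le> real (Suc k) powr (-r) * (2 * N / pi)" for k
    using bnd[OF aN[of "Suc k"] bN[of "Suc k"], of "cos (\<beta> (Suc k) * pi / 2)" "- sin (\<beta> (Suc k) * pi / 2)" "real (Suc k) powr (-r) / pi"]
    by (simp add: p_def mult.assoc del: of_nat_Suc)
  then have smp: "summable (\<lambda>k. \<bar>p k\<bar>)"
    by (intro summable_comparison_test'[OF smN]) (auto simp del: of_nat_Suc)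
  have "\<bar>q k\<bar> \<le> real (Suc k) powr (-r) * (2 * N / pi)" for k
    using bnd[OF aN[of "Suc k"] bN[of "Suc k"], of "sin (\<beta> (Suc k) * pi / 2)" "cos (\<beta> (Suc k) * pi / 2)" "real (Suc k) powr (-r) / pi"]
    by (simp add: q_def mult.assoc del: of_nat_Suc)
  then have smq: "summable (\<lambda>k. \<bar>q k\<bar>)"
    by (intro summable_comparison_test'[OF smN]) (auto simp del: of_nat_Suc)
  have ubnd: "\<bar>u k x\<bar> \<le> real (Suc k) powr (-r) * (N / pi)" for k x
    using HN[of "Suc k" x] by (simp add: u_def abs_mult divide_right_mono mult_left_mono del: of_nat_Suc)
  have smu: "summable (\<lambda>k. u k x)" for x
    by (rule summable_comparison_test'[OF summable_mult2[OF summable_powr_Suc[OF r1], of "N / pi"]])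
       (use ubnd in auto)
  have smH: "summable (\<lambda>k. real (Suc k) powr (-r) * H (Suc k) x)" for x
    using summable_mult[OF smu[of x], of pi] by (simp add: u_def del: of_nat_Suc)
  have fu: "f x = a0 / 2 + (\<Sum>k. u k x)" for x
    unfolding f Psi_convolution_sums[OF \<phi> r1] H_def[symmetric] u_def
    using suminf_mult[OF smH[of x], of "1 / pi"] by (simp del: of_nat_Suc)
  have S: "fourier_sum (n - 1) f x = a0 / 2 + (\<Sum>k<n - 1. u k x)" for x
    unfolding u_eq by (rule fourier_sum_trig_series[OF smp smq]) (simp add: fu u_eq del: of_nat_Suc)
  \<comment> \<open>Since \<open>u k\<close> is the harmonic \<open>Suc k\<close>, the harmonic
    \<open>n\<close> is \<open>u (n - 1)\<close> and the tail begins at \<open>u n\<close>.\<close>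
  define R where "R x = (\<Sum>j. u (j + n) x)" for x
  have "f x - fourier_sum (n - 1) f x = u (n - 1) x + R x" for x
  proof -
    have "(\<Sum>k. u k x) = R x + (\<Sum>k<n. u k x)"
      unfolding R_def by (rule suminf_split_initial_segment[OF smu])
    moreover have "(\<Sum>k<n. u k x) = (\<Sum>k<n - 1. u k x) + u (n - 1) x"
      using n by (cases n) auto
    ultimately show ?thesis using fu[of x] S[of x] by linarith
  qed
  moreover have "u (n - 1) x = real n powr (-r) / pi * H n x" for x
    using n by (simp add: u_def)
  moreover have "R \<in> borel_measurable borel"
    unfolding R_def u_eq by measurable
  moreover have "\<bar>R x\<bar> \<le> N / pi * tail_const * real (n + 1) powr (-r)" for x
  proof -
    let ?t = "\<lambda>j. N / pi * real (n + 1) powr (-r) * (4 / (real j + 2)\<^sup>2)"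
    have le: "norm (u (j + n) x) \<le> ?t j" for j
    proof -
      have "real (Suc (j + n)) powr (-r) \<le> real (n + 1) powr (-r) * (4 / (real j + 2)\<^sup>2)"
        using powr_tail_term[OF n r, of j] by (simp add: add_ac)
      then have "real (Suc (j + n)) powr (-r) * (N / pi) \<le> real (n + 1) powr (-r) * (4 / (real j + 2)\<^sup>2) * (N / pi)"
        using N0 by (intro mult_right_mono) auto
      then show ?thesis using ubnd[of "j + n" x] by (simp add: mult_ac)
    qed
    have sums: "summable ?t"
      by (intro summable_mult summable_inverse_squares_shift)
    have "\<bar>R x\<bar> \<le> (\<Sum>j. ?t j)"
      unfolding R_def real_norm_def[symmetric] by (rule norm_suminf_le[OF le sums])
    also have "\<dots> = N / pi * real (n + 1) powr (-r) * tail_const"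
      unfolding tail_const_def by (rule suminf_mult[OF summable_inverse_squares_shift])
    finally show ?thesis by (simp add: mult_ac)
  qed
  ultimately show ?thesis
    unfolding H_def by (intro bexI[of _ R] conjI allI) simp_all
qed

section \<open>Duality for the first harmonic\<close>

lemma conj_exp_ge_1:
  assumes "1 \<le> p"
  shows "1 \<le> conj_exp p"
proof (cases p)
  case (real P)
  with assms show ?thesis
    by (auto simp: conj_exp_def one_ereal_def field_simps)
qed (use assms in \<open>auto simp: conj_exp_def\<close>)

lemma conj_exp_ereal: "P > 1 \<Longrightarrow> conj_exp (ereal P) = ereal (P / (P - 1))"
  by (simp add: conj_exp_def one_ereal_def)

lemma lpnorm_cos_ereal:
  "P \<ge> 1 \<Longrightarrow> lpnorm (ereal P) cos = ereal ((\<integral>t. \<bar>cos t\<bar> powr P \<partial>Leb2pi) powr (1 / P))"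
  by (rule lpnorm_ereal[where B=1]) auto

text \<open>The exponent is left as \<open>powr 1\<close> so that the dilation rule for powers of
  the cosine applies as it stands.\<close>

lemma lpnorm_cos_1: "lpnorm 1 cos = ereal (\<integral>t. \<bar>cos t\<bar> powr 1 \<partial>Leb2pi)"
proof -
  have "(\<integral>t. \<bar>cos t\<bar> \<partial>Leb2pi) \<ge> 0"
    by (rule integral_nonneg_AE) simp
  then show ?thesis
    using lpnorm_cos_ereal[of 1] by (simp add: one_ereal_def)
qed

lemma lpnorm_cos_infinity: "lpnorm \<infinity> cos = 1"
  using lpnorm_infinity_cos_dilate[of 1 0] by simp

text \<open>Hoelder's inequality; the bound is uniform in \<open>y\<close> and \<open>n\<close>
  because the norm of a cosine depends neither on its frequency nor on its phase.\<close>

lemma U0_cos_bound: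
  assumes p: "1 \<le> p" and n: "n \<ge> 1" and \<phi>: "\<phi> \<in> U0 p" and D: "lpnorm (conj_exp p) cos = ereal D"
  shows "\<bar>\<integral>t. cos (y - real n * t) * \<phi> t \<partial>Leb2pi\<bar> \<le> D"
proof -
  define C where "C t = cos (real n * t + (- y))" for t
  have Cy: "cos (y - real n * t) = C t" for t
    unfolding C_def using cos_minus[of "y - real n * t"] by simp
  have C1: "\<bar>C t\<bar> \<le> 1" for t by (simp add: C_def)
  have [measurable]: "C \<in> borel_measurable borel" unfolding C_def by measurable
  note int\<phi> = U0_integrable(1)[OF \<phi> p]
  have intC: "integrable Leb2pi (\<lambda>t. \<bar>C t * \<phi> t\<bar>)"
    using C1 int\<phi> by (intro integrable_abs integrable_Leb2pi_mult_bounded) auto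
  have "(\<integral>t. \<bar>C t * \<phi> t\<bar> \<partial>Leb2pi) \<le> D"
  proof (cases p)
    case (real P)
    show ?thesis
    proof (cases "P = 1")
      case True
      with real have "D = 1"
        using D by (simp add: conj_exp_def one_ereal_def lpnorm_cos_infinity)
      have "(\<integral>t. \<bar>C t * \<phi> t\<bar> \<partial>Leb2pi) \<le> (\<integral>t. \<bar>\<phi> t\<bar> \<partial>Leb2pi)"
        using intC int\<phi> C1 by (intro integral_mono) (auto simp: abs_mult mult_left_le_one_le)
      also have "\<dots> \<le> 1"
        using U0_ereal(2)[of \<phi> 1] \<phi> real True by simp
      finally show ?thesis using \<open>D = 1\<close> by simp
    next
      case False
      with real p have P: "P > 1" by simp
      define Q where "Q = P / (P - 1)"
      have Q: "Q > 1" "1 / Q + 1 / P = 1"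
        using P by (auto simp: Q_def field_simps)
      define I where "I = (\<integral>t. \<bar>cos t\<bar> powr Q \<partial>Leb2pi)"
      have I: "I > 0" "D = I powr (1 / Q)"
        using integral_cos_powr_pos[of Q] Q D lpnorm_cos_ereal[of Q] real P
        by (auto simp: I_def conj_exp_ereal Q_def)
      then have D0: "D > 0" by simp
      have DQ: "D powr Q = I" using I Q by (simp add: powr_powr)
      have intCQ: "integrable Leb2pi (\<lambda>t. \<bar>C t\<bar> powr Q)"
        using C1 Q by (intro integrable_Leb2pi_powr) auto
      have int\<phi>P: "integrable Leb2pi (\<lambda>t. \<bar>\<phi> t\<bar> powr P)" and \<phi>1: "(\<integral>t. \<bar>\<phi> t\<bar> powr P \<partial>Leb2pi) \<le> 1"
        using U0_ereal[of \<phi> P] \<phi> real P by auto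
      have IC: "(\<integral>t. \<bar>C t\<bar> powr Q \<partial>Leb2pi) = I"
        unfolding C_def I_def using Q n by (intro integral_cos_powr_dilate) auto
      \<comment> \<open>Young's inequality is applied after dividing the cosine by its norm
        \<open>D\<close>; then \<open>D powr Q = I\<close> makes the two integrals contribute at
        most \<open>1 / Q\<close> and \<open>1 / P\<close>, which add up to
        \<open>1\<close>.\<close>
      have pt: "\<bar>C t * \<phi> t\<bar> \<le> D * (\<bar>C t\<bar> powr Q / I / Q + \<bar>\<phi> t\<bar> powr P / P)" for t
      proof -
        have "\<bar>C t\<bar> / D * \<bar>\<phi> t\<bar> \<le> (\<bar>C t\<bar> / D) powr Q / Q + \<bar>\<phi> t\<bar> powr P / P"
          using Q P D0 by (intro Youngs_inequality) auto
        then have "\<bar>C t\<bar> / D * \<bar>\<phi> t\<bar> \<le> \<bar>C t\<bar> powr Q / I / Q + \<bar>\<phi> t\<bar> powr P / P"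
          using D0 DQ by (simp add: powr_divide)
        then have "D * (\<bar>C t\<bar> / D * \<bar>\<phi> t\<bar>) \<le> D * (\<bar>C t\<bar> powr Q / I / Q + \<bar>\<phi> t\<bar> powr P / P)"
          using D0 by (intro mult_left_mono) auto
        then show ?thesis using D0 by (simp add: abs_mult)
      qed
      have "(\<integral>t. \<bar>C t * \<phi> t\<bar> \<partial>Leb2pi) \<le> (\<integral>t. D * (\<bar>C t\<bar> powr Q / I / Q + \<bar>\<phi> t\<bar> powr P / P) \<partial>Leb2pi)"
        using intC pt intCQ int\<phi>P by (intro integral_mono) auto
      also have "\<dots> = D * (1 / Q + (\<integral>t. \<bar>\<phi> t\<bar> powr P \<partial>Leb2pi) / P)"
        using intCQ int\<phi>P IC I by simp
      also have "\<dots> \<le> D * (1 / Q + 1 / P)"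
        using \<phi>1 D0 P by (intro mult_left_mono add_left_mono divide_right_mono) auto
      finally show ?thesis using Q by simp
    qed
  next
    case PInf
    then have D: "D = (\<integral>t. \<bar>cos t\<bar> powr 1 \<partial>Leb2pi)"
      using D by (simp add: conj_exp_def lpnorm_cos_1)
    have "AE t in Leb2pi. \<bar>\<phi> t\<bar> \<le> 1"
      using U0_infinity \<phi> PInf by simp
    then have "AE t in Leb2pi. \<bar>C t * \<phi> t\<bar> \<le> \<bar>C t\<bar> powr 1"
      by eventually_elim (simp add: abs_mult mult_left_le)
    then have "(\<integral>t. \<bar>C t * \<phi> t\<bar> \<partial>Leb2pi) \<le> (\<integral>t. \<bar>C t\<bar> powr 1 \<partial>Leb2pi)"
      using intC integrable_Leb2pi_powr[of C 1 1] C1 by (intro integral_mono_AE) auto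
    also have "\<dots> = D"
      unfolding C_def D using n by (intro integral_cos_powr_dilate) auto
    finally show ?thesis .
  qed (use p in auto)
  then show ?thesis
    unfolding Cy using integral_abs_bound[of Leb2pi "\<lambda>t. C t * \<phi> t"] by linarith
qed

lemma sin_eq_cos_shift: "sin (c * t) = cos (c * t + (- pi / 2))" for c t :: real
  by (simp add: cos_diff)

text \<open>For odd \<open>h\<close> both \<open>h (sin (n t))\<close> and its product with
  \<open>cos (n t)\<close> are odd in \<open>t\<close>. This yields the mean value zero and leaves
  only the sine coefficient. The bound on \<open>h\<close> is asked on \<open>[-1, 1]\<close> alone,
  since powers are unbounded on the line.\<close>

lemma U0_odd_sin:
  fixes h :: "real \<Rightarrow> real"
  assumes h: "h \<in> borel_measurable borel" "\<And>y. h (- y) = - h y" "\<And>y. \<bar>y\<bar> \<le> 1 \<Longrightarrow> \<bar>h y\<bar> \<le> B"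
    and norm: "lpnorm p (\<lambda>t. h (sin (real n * t))) \<le> 1" and p: "1 \<le> p"
  shows "(\<lambda>t. h (sin (real n * t))) \<in> U0 p"
    and "(\<integral>t. cos (real n * t) * h (sin (real n * t)) \<partial>Leb2pi) = 0"
proof -
  note [measurable] = h(1)
  have B: "\<bar>h (sin (real n * t))\<bar> \<le> B" for t
    by (rule h(3)) simp
  have "sin (real n * (t + 2 * pi)) = sin (real n * t)" for t
    using sin.plus_of_nat[of "real n * t" n] by (simp add: algebra_simps)
  then have per: "per2pi (\<lambda>t. h (sin (real n * t)))"
    by (simp add: per2pi_def)
  have "in_Lp p (\<lambda>t. h (sin (real n * t)))"
  proof (cases p)
    case (real P)
    then show ?thesis
      using per p integrable_Leb2pi_powr[of "\<lambda>t. h (sin (real n * t))" B P] B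
      by (auto simp: in_Lp_def intro!: measurable_completion)
  next
    case PInf
    have "esssup Leb2pi (\<lambda>t. ereal \<bar>h (sin (real n * t))\<bar>) \<le> 1"
      using norm PInf by (simp add: lpnorm_def)
    also have "\<dots> < \<infinity>" by simp
    finally show ?thesis
      using per PInf by (auto simp: in_Lp_def intro!: measurable_completion)
  qed (use p in auto)
  moreover have "(\<integral>t. h (sin (real n * t)) \<partial>Leb2pi) = 0"
    using B h(2) by (intro integral_Leb2pi_odd[where B=B]) auto
  ultimately show "(\<lambda>t. h (sin (real n * t))) \<in> U0 p"
    using norm by (simp add: U0_def)
  have "\<bar>cos (real n * t) * h (sin (real n * t))\<bar> \<le> B" for t
    using B[of t] mult_mono[of "\<bar>cos (real n * t)\<bar>" 1 "\<bar>h (sin (real n * t))\<bar>" B] by (simp add: abs_mult)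
  then show "(\<integral>t. cos (real n * t) * h (sin (real n * t)) \<partial>Leb2pi) = 0"
    using h(2) by (intro integral_Leb2pi_odd[where B=B]) auto
qed

text \<open>Sharpness of Hoelder's inequality: \<open>h\<close> is a signed power for finite
  \<open>p > 1\<close> and the sign for infinite \<open>p\<close>, where \<open>D\<close> is
  attained. For \<open>p = 1\<close> the mass is concentrated near the peaks of the sine, at the
  cost of \<open>\<delta>\<close>.\<close>

lemma U0_extremal:
  assumes p: "1 \<le> p" and n: "n \<ge> 1" and D: "lpnorm (conj_exp p) cos = ereal D" and \<delta>: "\<delta> > 0"
  obtains \<phi> where "\<phi> \<in> U0 p" "(\<integral>t. cos (real n * t) * \<phi> t \<partial>Leb2pi) = 0"
    "D - \<delta> \<le> (\<integral>t. sin (real n * t) * \<phi> t \<partial>Leb2pi)"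
proof -
  note witness = that
  have sinpow: "(\<integral>t. \<bar>sin (real n * t)\<bar> powr Q \<partial>Leb2pi) = (\<integral>t. \<bar>cos t\<bar> powr Q \<partial>Leb2pi)" if "Q \<ge> 1" for Q
    unfolding sin_eq_cos_shift using that n by (intro integral_cos_powr_dilate)
  have ?thesis if h: "h \<in> borel_measurable borel" "\<And>y. h (- y) = - h y" "\<And>y. \<bar>y\<bar> \<le> 1 \<Longrightarrow> \<bar>h y\<bar> \<le> B"
    and "lpnorm p (\<lambda>t. h (sin (real n * t))) \<le> 1"
    and "D - \<delta> \<le> (\<integral>t. sin (real n * t) * h (sin (real n * t)) \<partial>Leb2pi)" for h :: "real \<Rightarrow> real" and B
    by (rule witness[OF U0_odd_sin[where h=h and B=B, OF h that(4) p] that(5)])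
  note goalI = this
  show ?thesis
  proof (cases p)
    case (real P)
    show ?thesis
    proof (cases "P = 1")
      case True
      with real have "D = 1"
        using D by (simp add: conj_exp_def one_ereal_def lpnorm_cos_infinity)
      \<comment> \<open>The weight \<open>w\<close> lives where the sine exceeds
        \<open>c \<ge> D - \<delta>\<close> in modulus, so an average against it is at least
        \<open>c\<close>. The maximum with \<open>0\<close> ensures
        \<open>w y \<le> \<bar>y\<bar>\<close>, hence boundedness.\<close>
      define c where "c = max 0 (1 - \<delta>)"
      define w where "w y = max 0 (\<bar>y\<bar> - c)" for y :: real
      have c: "0 \<le> c" "c < 1" "1 - \<delta> \<le> c" using \<delta> by (auto simp: c_def)
      define W where "W = (\<integral>t. w (sin (real n * t)) \<partial>Leb2pi)"
      have W: "W > 0"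
        unfolding W_def w_def sin_eq_cos_shift by (rule integral_cos_peak_pos[OF c(2) n])
      have [measurable]: "w \<in> borel_measurable borel" unfolding w_def by measurable
      have w0: "0 \<le> w y" "w y \<le> \<bar>y\<bar>" for y using c by (auto simp: w_def)
      have intw: "integrable Leb2pi (\<lambda>t. w (sin (real n * t)))"
        using w0(1) order_trans[OF w0(2) abs_sin_le_one] by (intro integrable_Leb2pi_bounded[where B=1]) auto
      \<comment> \<open>Division by \<open>W\<close> normalises the \<open>L_1\<close> norm to one;
        the sign makes \<open>h\<close> odd and \<open>y * h y\<close> nonnegative.\<close>
      define h where "h y = sgn y * w y / W" for y
      have ah: "\<bar>h y\<bar> = w y / W" for y
        using w0[of y] W by (auto simp: h_def abs_mult sgn_if)
      have yh: "y * h y = \<bar>y\<bar> * w y / W" for y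
        by (auto simp: h_def sgn_if)
      show ?thesis
      proof (rule goalI[of h "1 / W"])
        show "h \<in> borel_measurable borel" unfolding h_def by measurable
        show "h (- y) = - h y" for y by (simp add: h_def w_def sgn_minus)
        show "\<bar>h y\<bar> \<le> 1 / W" if "\<bar>y\<bar> \<le> 1" for y
          using w0[of y] that W by (simp add: ah divide_right_mono)
        have "(\<integral>t. \<bar>h (sin (real n * t))\<bar> powr 1 \<partial>Leb2pi) = 1"
          using w0 W by (simp add: ah W_def[symmetric])
        moreover have "integrable Leb2pi (\<lambda>t. \<bar>h (sin (real n * t))\<bar>)"
          using intw by (simp add: ah)
        ultimately show "lpnorm p (\<lambda>t. h (sin (real n * t))) \<le> 1"
          using real True by (simp add: lpnorm_def one_ereal_def)
        have "c = (\<integral>t. c * w (sin (real n * t)) / W \<partial>Leb2pi)"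
          using W by (simp add: W_def[symmetric])
        also have "\<dots> \<le> (\<integral>t. \<bar>sin (real n * t)\<bar> * w (sin (real n * t)) / W \<partial>Leb2pi)"
        proof (rule integral_mono)
          show "integrable Leb2pi (\<lambda>t. c * w (sin (real n * t)) / W)" using intw by simp
          have "integrable Leb2pi (\<lambda>t. \<bar>sin (real n * t)\<bar> * w (sin (real n * t)))"
            using intw by (rule integrable_Leb2pi_mult_bounded) auto
          then show "integrable Leb2pi (\<lambda>t. \<bar>sin (real n * t)\<bar> * w (sin (real n * t)) / W)" by simp
          show "c * w (sin (real n * t)) / W \<le> \<bar>sin (real n * t)\<bar> * w (sin (real n * t)) / W" for t
            using W by (intro divide_right_mono) (auto simp: w_def max_def intro!: mult_right_mono)
        qed
        finally show "D - \<delta> \<le> (\<integral>t. sin (real n * t) * h (sin (real n * t)) \<partial>Leb2pi)"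
          using c \<open>D = 1\<close> by (simp add: yh)
      qed
    next
      case False
      with real p have P: "P > 1" by simp
      define Q where "Q = P / (P - 1)"
      have Q: "Q > 1" "1 - 1 / P = 1 / Q" "(Q - 1) * P = Q"
        using P by (auto simp: Q_def field_simps)
      define I where "I = (\<integral>t. \<bar>cos t\<bar> powr Q \<partial>Leb2pi)"
      have I: "I > 0" "D = I powr (1 / Q)"
        using integral_cos_powr_pos[of Q] Q D lpnorm_cos_ereal[of Q] real P
        by (auto simp: I_def conj_exp_ereal Q_def)
      \<comment> \<open>This factor gives \<open>h (sin (n t))\<close> the \<open>L_P\<close> norm
        one, as \<open>(Q - 1) * P = Q\<close>, and the pairing with the sine then equals
        \<open>c * I = I powr (1 / Q) = D\<close>.\<close>
      define c where "c = I powr (- 1 / P)"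
      have "c powr P = I powr (- 1)"
        using P by (simp add: c_def powr_powr)
      moreover have "c * I = I powr (- 1 / P + 1)"
        using I powr_add[of I "- 1 / P" 1] by (simp add: c_def)
      moreover have "- 1 / P + 1 = 1 / Q"
        using Q(2) by simp
      ultimately have c: "c > 0" "c powr P = 1 / I" "c * I = D"
        using I by (simp_all add: c_def powr_minus_divide)
      define h where "h y = c * (sgn y * \<bar>y\<bar> powr (Q - 1))" for y
      have hP: "\<bar>h y\<bar> powr P = \<bar>y\<bar> powr Q / I" for y
        using c Q(3) by (simp add: h_def abs_mult powr_mult powr_powr abs_sgn_eq)
      have yh: "y * h y = c * \<bar>y\<bar> powr Q" for y
        using powr_add[of "\<bar>y\<bar>" 1 "Q - 1"] by (auto simp: h_def sgn_if)
      show ?thesis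
      proof (rule goalI[of h c])
        show hm: "h \<in> borel_measurable borel" unfolding h_def by measurable
        show "h (- y) = - h y" for y by (simp add: h_def sgn_minus)
        show hc: "\<bar>h y\<bar> \<le> c" if "\<bar>y\<bar> \<le> 1" for y
          using that c Q powr_le1[of "Q - 1" "\<bar>y\<bar>"] by (auto simp: h_def abs_mult abs_sgn_eq)
        have "(\<integral>t. \<bar>h (sin (real n * t))\<bar> powr P \<partial>Leb2pi) = 1"
          using I sinpow[of Q] Q by (simp add: hP flip: I_def)
        moreover have "lpnorm (ereal P) (\<lambda>t. h (sin (real n * t)))
            = ereal ((\<integral>t. \<bar>h (sin (real n * t))\<bar> powr P \<partial>Leb2pi) powr (1 / P))"
          using hm hc P by (intro lpnorm_ereal[where B=c]) auto
        ultimately show "lpnorm p (\<lambda>t. h (sin (real n * t))) \<le> 1"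
          using real by (simp add: one_ereal_def)
        show "D - \<delta> \<le> (\<integral>t. sin (real n * t) * h (sin (real n * t)) \<partial>Leb2pi)"
          using c sinpow[of Q] Q \<delta> by (simp add: yh flip: I_def)
      qed
    qed
  next
    case PInf
    then have D: "D = (\<integral>t. \<bar>cos t\<bar> powr 1 \<partial>Leb2pi)"
      using D by (simp add: conj_exp_def lpnorm_cos_1)
    show ?thesis
    proof (rule goalI[of sgn 1])
      have "(\<lambda>t. ereal \<bar>sgn (sin (real n * t))\<bar>) \<in> borel_measurable Leb2pi"
        by (rule borel_measurable_Leb2pi) measurable
      moreover have "ereal \<bar>sgn (sin (real n * t))\<bar> \<le> 1" for t
        by (simp add: abs_sgn_eq one_ereal_def)
      ultimately have "esssup Leb2pi (\<lambda>t. ereal \<bar>sgn (sin (real n * t))\<bar>) \<le> 1"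
        by (intro esssup_I AE_I2)
      then show "lpnorm p (\<lambda>t. sgn (sin (real n * t))) \<le> 1"
        using PInf by (simp add: lpnorm_def)
      have "sin (real n * t) * sgn (sin (real n * t)) = \<bar>sin (real n * t)\<bar> powr 1" for t
        by (simp add: sgn_if)
      then show "D - \<delta> \<le> (\<integral>t. sin (real n * t) * sgn (sin (real n * t)) \<partial>Leb2pi)"
        using sinpow[of 1] D \<delta> by simp
    qed (auto simp: abs_sgn_eq sgn_minus)
  qed (use p in auto)
qed

section \<open>The deviations of the classes\<close>

text \<open>The factor \<open>2 * pi + 1\<close> is the common \<open>L_1\<close> bound of the unit
  balls for all \<open>p\<close>, so the constant depends on no parameter.\<close>

definition remainder_const :: real where
  "remainder_const = (2 * pi + 1) / pi * tail_const"

lemma remainder_const_pos: "remainder_const > 0"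
  unfolding remainder_const_def using tail_const_pos by (intro mult_pos_pos divide_pos_pos add_pos_pos) auto

lemma Wclass_decompose:
  assumes "f \<in> Wclass \<beta> r p" "1 \<le> p" "n \<ge> 1" "real n + 1 \<le> r"
  shows "\<exists>\<phi>\<in>U0 p. \<exists>R\<in>borel_measurable borel. (\<forall>x. \<bar>R x\<bar> \<le> remainder_const * real (n + 1) powr (-r))
    \<and> (\<forall>x. f x - fourier_sum (n - 1) f x
      = real n powr (-r) / pi * (\<integral>t. cos (real n * x - \<beta> n * pi / 2 - real n * t) * \<phi> t \<partial>Leb2pi) + R x)"
proof -
  obtain a0 \<phi> where \<phi>: "\<phi> \<in> U0 p"
    and f: "\<And>x. f x = a0 / 2 + 1 / pi * (\<integral>t. Psi \<beta> r (x - t) * \<phi> t \<partial>Leb2pi)"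
    using assms(1) by (auto simp: Wclass_def)
  show ?thesis
    unfolding remainder_const_def
    using Wclass_remainder[OF assms(3,4) U0_integrable[OF \<phi> assms(2)] f] \<phi>
    by (rule bexI[where x=\<phi>])
qed

lemma Wclass_of_U0:
  assumes "\<phi> \<in> U0 p" "1 \<le> p" "n \<ge> 1" "real n + 1 \<le> r"
  shows "\<exists>f\<in>Wclass \<beta> r p. \<exists>R\<in>borel_measurable borel. (\<forall>x. \<bar>R x\<bar> \<le> remainder_const * real (n + 1) powr (-r))
    \<and> (\<forall>x. f x - fourier_sum (n - 1) f x
      = real n powr (-r) / pi * (\<integral>t. cos (real n * x - \<beta> n * pi / 2 - real n * t) * \<phi> t \<partial>Leb2pi) + R x)"
proof -
  \<comment> \<open>The term \<open>0 / 2\<close> keeps the shape of the class with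
    \<open>a0 = 0\<close>.\<close>
  define f where "f x = 0 / 2 + 1 / pi * (\<integral>t. Psi \<beta> r (x - t) * \<phi> t \<partial>Leb2pi)" for x
  have "f \<in> Wclass \<beta> r p"
    unfolding Wclass_def using assms(1) f_def by blast
  with Wclass_remainder[OF assms(3,4) U0_integrable[OF assms(1,2)] f_def] show ?thesis
    unfolding remainder_const_def by (rule bexI[where x=f])
qed

section \<open>Two-sided bounds in the uniform norm\<close>

lemma eps_C_upper:
  assumes p: "1 \<le> p" and n: "n \<ge> 1" and r: "real n + 1 \<le> r" and D: "lpnorm (conj_exp p) cos = ereal D"
  shows "eps_C n (Wclass \<beta> r p)
    \<le> ereal (real n powr (-r) * (D / pi) + remainder_const * real (n + 1) powr (-r))"
  unfolding eps_C_def cnorm_def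
proof (intro SUP_least)
  fix f x assume f: "f \<in> Wclass \<beta> r p"
  obtain \<phi> R where \<phi>: "\<phi> \<in> U0 p" and "R \<in> borel_measurable borel"
    and R: "\<And>x. \<bar>R x\<bar> \<le> remainder_const * real (n + 1) powr (-r)"
    and eq: "\<And>x. f x - fourier_sum (n - 1) f x
      = real n powr (-r) / pi * (\<integral>t. cos (real n * x - \<beta> n * pi / 2 - real n * t) * \<phi> t \<partial>Leb2pi) + R x"
    using Wclass_decompose[OF f p n r] by blast
  have "\<bar>real n powr (-r) / pi * (\<integral>t. cos (real n * x - \<beta> n * pi / 2 - real n * t) * \<phi> t \<partial>Leb2pi)\<bar>
      \<le> real n powr (-r) / pi * D"
    unfolding abs_mult using U0_cos_bound[OF p n \<phi> D] by (simp add: divide_right_mono mult_left_mono)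
  with R[of x] show "ereal \<bar>f x - fourier_sum (n - 1) f x\<bar>
      \<le> ereal (real n powr (-r) * (D / pi) + remainder_const * real (n + 1) powr (-r))"
    unfolding eq ereal_less_eq by (simp only: times_divide_eq_left times_divide_eq_right)
qed

lemma eps_C_lower:
  assumes p: "1 \<le> p" and n: "n \<ge> 1" and r: "real n + 1 \<le> r" and D: "lpnorm (conj_exp p) cos = ereal D"
    and \<delta>: "\<delta> > 0"
  shows "ereal (real n powr (-r) * (D / pi - \<delta>) - remainder_const * real (n + 1) powr (-r))
    \<le> eps_C n (Wclass \<beta> r p)"
proof -
  \<comment> \<open>The scaling anticipates the factor \<open>1 / pi\<close> in front of the
    convolution.\<close>
  from \<delta> have "pi * \<delta> > 0" by simp
  from U0_extremal[OF p n D this] obtain \<phi> where \<phi>: "\<phi> \<in> U0 p" "(\<integral>t. cos (real n * t) * \<phi> t \<partial>Leb2pi) = 0"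
    and A: "D - pi * \<delta> \<le> (\<integral>t. sin (real n * t) * \<phi> t \<partial>Leb2pi)" by blast
  obtain f R where f: "f \<in> Wclass \<beta> r p" and "R \<in> borel_measurable borel"
    and R: "\<And>x. \<bar>R x\<bar> \<le> remainder_const * real (n + 1) powr (-r)"
    and eq: "\<And>x. f x - fourier_sum (n - 1) f x
      = real n powr (-r) / pi * (\<integral>t. cos (real n * x - \<beta> n * pi / 2 - real n * t) * \<phi> t \<partial>Leb2pi) + R x"
    using Wclass_of_U0[OF \<phi>(1) p n r, where \<beta>=\<beta>] by blast
  \<comment> \<open>At this point the phase of the main term is \<open>pi / 2\<close> whatever
    \<open>\<beta> n\<close> is, so the main term equals the nearly extremal sine coefficient times
    its factor.\<close>
  define x where "x = (\<beta> n * pi / 2 + pi / 2) / real n"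
  have x: "real n * x - \<beta> n * pi / 2 = pi / 2"
    using n by (simp add: x_def)
  have "f x - fourier_sum (n - 1) f x = real n powr (-r) / pi * (\<integral>t. sin (real n * t) * \<phi> t \<partial>Leb2pi) + R x"
    unfolding eq integral_cos_shift_expand[OF U0_integrable(1)[OF \<phi>(1) p]] x by simp
  moreover have "real n powr (-r) / pi * (D - pi * \<delta>) \<le> real n powr (-r) / pi * (\<integral>t. sin (real n * t) * \<phi> t \<partial>Leb2pi)"
    using A by (intro mult_left_mono) auto
  moreover have "real n powr (-r) / pi * (D - pi * \<delta>) = real n powr (-r) * (D / pi - \<delta>)"
    by (simp add: field_simps)
  ultimately have "real n powr (-r) * (D / pi - \<delta>) - remainder_const * real (n + 1) powr (-r)
      \<le> \<bar>f x - fourier_sum (n - 1) f x\<bar>"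
    using R[of x] by linarith
  then have "ereal (real n powr (-r) * (D / pi - \<delta>) - remainder_const * real (n + 1) powr (-r))
      \<le> ereal \<bar>f x - fourier_sum (n - 1) f x\<bar>" by simp
  also have "\<dots> \<le> cnorm (\<lambda>x. f x - fourier_sum (n - 1) f x)"
    unfolding cnorm_def by (rule SUP_upper) simp
  also have "\<dots> \<le> eps_C n (Wclass \<beta> r p)"
    unfolding eps_C_def by (rule SUP_upper[OF f])
  finally show ?thesis .
qed

lemma lpnorm_conj_exp_1: "lpnorm (conj_exp 1) cos = ereal 1"
  by (simp add: conj_exp_def lpnorm_cos_infinity one_ereal_def)

lemma lpnorm_cmult_cos_dilate:
  assumes "1 \<le> p" "n \<ge> 1" "lpnorm p cos = ereal D"
  shows "lpnorm p (\<lambda>x. c * cos (real n * x + b)) = ereal (\<bar>c\<bar> * D)"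
  using lpnorm_cmult[of "\<lambda>x. cos (real n * x + b)" 1 p c] lpnorm_cos_dilate[OF assms(1,2)] assms by simp

section \<open>Two-sided bounds in the integral norms\<close>

lemma eps_L_upper:
  assumes p: "1 \<le> p" and n: "n \<ge> 1" and r: "real n + 1 \<le> r" and D: "lpnorm p cos = ereal D" "0 \<le> D"
  shows "eps_L p n (Wclass \<beta> r 1)
    \<le> ereal (real n powr (-r) * (D / pi) + 2 * pi * remainder_const * real (n + 1) powr (-r))"
  unfolding eps_L_def
proof (intro SUP_least)
  fix f assume f: "f \<in> Wclass \<beta> r 1"
  obtain \<phi> R where \<phi>: "\<phi> \<in> U0 1" and Rm: "R \<in> borel_measurable borel"
    and R: "\<And>x. \<bar>R x\<bar> \<le> remainder_const * real (n + 1) powr (-r)"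
    and eq: "\<And>x. f x - fourier_sum (n - 1) f x
      = real n powr (-r) / pi * (\<integral>t. cos (real n * x - \<beta> n * pi / 2 - real n * t) * \<phi> t \<partial>Leb2pi) + R x"
    using Wclass_decompose[OF f order_refl n r] by blast
  have int: "integrable Leb2pi \<phi>" using U0_integrable(1)[OF \<phi>] by simp
  \<comment> \<open>Polar coordinates of the two coefficients turn the main term into a single
    cosine, whose norm is its amplitude times the norm of \<open>cos\<close>.\<close>
  obtain A \<theta> where A: "(\<integral>t. cos (real n * t) * \<phi> t \<partial>Leb2pi) = A * cos \<theta>"
    "(\<integral>t. sin (real n * t) * \<phi> t \<partial>Leb2pi) = A * sin \<theta>"
    using polar_Ex by blast
  have cosA: "(\<integral>t. cos (y - real n * t) * \<phi> t \<partial>Leb2pi) = A * cos (y - \<theta>)" for y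
  proof -
    have "(\<integral>t. cos (y - real n * t) * \<phi> t \<partial>Leb2pi) = cos y * (A * cos \<theta>) + sin y * (A * sin \<theta>)"
      unfolding integral_cos_shift_expand[OF int] A ..
    also have "\<dots> = A * cos (y - \<theta>)"
      by (simp add: cos_diff algebra_simps)
    finally show ?thesis .
  qed
  \<comment> \<open>At \<open>y = \<theta>\<close> the convolution equals \<open>A\<close>, and for
    \<open>p = 1\<close> the dual norm of the cosine is \<open>1\<close>.\<close>
  have A1: "\<bar>A\<bar> \<le> 1"
    using U0_cos_bound[OF _ n \<phi> lpnorm_conj_exp_1, of \<theta>] by (simp add: cosA)
  let ?u = "\<lambda>x. (real n powr (-r) / pi * A) * cos (real n * x + (- \<beta> n * pi / 2 - \<theta>))"
  have "lpnorm p (\<lambda>x. f x - fourier_sum (n - 1) f x) = lpnorm p (\<lambda>x. ?u x + R x)"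
    unfolding eq cosA by (simp add: algebra_simps)
  also have "\<dots> \<le> lpnorm p ?u + ereal (2 * pi * (remainder_const * real (n + 1) powr (-r)))"
  proof (rule lpnorm_add_bounded[OF _ _ Rm R])
    show "\<bar>?u x\<bar> \<le> \<bar>real n powr (-r) / pi * A\<bar>" for x
      unfolding abs_mult[of "real n powr (-r) / pi * A"] by (rule mult_left_le) auto
  qed (use remainder_const_pos p in auto)
  also have "lpnorm p ?u = ereal (\<bar>real n powr (-r) / pi * A\<bar> * D)"
    by (rule lpnorm_cmult_cos_dilate[OF p n D(1)])
  also have "\<dots> \<le> ereal (real n powr (-r) * (D / pi))"
  proof -
    have "real n powr (-r) / pi * (\<bar>A\<bar> * D) \<le> real n powr (-r) / pi * D"
      using A1 D(2) by (intro mult_left_mono mult_left_le_one_le) auto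
    then show ?thesis by (simp add: abs_mult mult.assoc)
  qed
  finally show "lpnorm p (\<lambda>x. f x - fourier_sum (n - 1) f x)
      \<le> ereal (real n powr (-r) * (D / pi) + 2 * pi * remainder_const * real (n + 1) powr (-r))"
    by (simp add: mult.assoc add_right_mono)
qed

lemma eps_L_lower:
  assumes p: "1 \<le> p" and n: "n \<ge> 1" and r: "real n + 1 \<le> r" and D: "lpnorm p cos = ereal D" "0 \<le> D"
    and \<delta>: "\<delta> > 0"
  shows "ereal (real n powr (-r) * (D / pi - \<delta>) - 2 * pi * remainder_const * real (n + 1) powr (-r))
    \<le> eps_L p n (Wclass \<beta> r 1)"
proof -
  \<comment> \<open>A loss \<open>d\<close> in amplitude costs \<open>D * d\<close> in the norm; the
    denominator \<open>D + 1\<close> is positive and keeps this cost below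
    \<open>pi * \<delta>\<close>.\<close>
  define d where "d = pi * \<delta> / (D + 1)"
  have d: "d > 0" "D * d \<le> pi * \<delta>"
    using \<delta> D(2) by (auto simp: d_def field_simps)
  from U0_extremal[OF _ n lpnorm_conj_exp_1 d(1)] obtain \<phi>
    where \<phi>: "\<phi> \<in> U0 1" "(\<integral>t. cos (real n * t) * \<phi> t \<partial>Leb2pi) = 0"
    and A': "1 - d \<le> (\<integral>t. sin (real n * t) * \<phi> t \<partial>Leb2pi)" by auto
  define A where "A = (\<integral>t. sin (real n * t) * \<phi> t \<partial>Leb2pi)"
  obtain f R where f: "f \<in> Wclass \<beta> r 1"
    and Rm [measurable]: "R \<in> borel_measurable borel"
    and R: "\<And>x. \<bar>R x\<bar> \<le> remainder_const * real (n + 1) powr (-r)"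
    and eq: "\<And>x. f x - fourier_sum (n - 1) f x
      = real n powr (-r) / pi * (\<integral>t. cos (real n * x - \<beta> n * pi / 2 - real n * t) * \<phi> t \<partial>Leb2pi) + R x"
    using Wclass_of_U0[OF \<phi>(1) order_refl n r, where \<beta>=\<beta>] by blast
  have int: "integrable Leb2pi \<phi>" using U0_integrable(1)[OF \<phi>(1)] by simp
  let ?c = "real n powr (-r) / pi * A"
  let ?u = "\<lambda>x. ?c * cos (real n * x + (- \<beta> n * pi / 2 - pi / 2))"
  let ?g = "\<lambda>x. f x - fourier_sum (n - 1) f x"
  have "cos (y + (- b - pi / 2)) = sin (y - b)" for y b :: real
    using sin_cos_eq[of "y - b"] cos_minus[of "y - b - pi / 2"] by (simp add: algebra_simps)
  then have gu: "?g = (\<lambda>x. ?u x + R x)"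
    unfolding eq integral_cos_shift_expand[OF int] \<phi>(2) A_def[symmetric] by (simp add: fun_eq_iff)
  have ub: "\<bar>?u x\<bar> \<le> \<bar>?c\<bar>" for x
    unfolding abs_mult[of ?c] by (rule mult_left_le) auto
  have gb: "\<bar>?u x + R x\<bar> \<le> \<bar>?c\<bar> + remainder_const * real (n + 1) powr (-r)" for x
    using ub[of x] R[of x] by linarith
  have "ereal (real n powr (-r) * (D / pi - \<delta>)) \<le> ereal (\<bar>?c\<bar> * D)"
  proof -
    have "D - pi * \<delta> \<le> (1 - d) * D" using d(2) by (simp add: algebra_simps)
    also have "\<dots> \<le> \<bar>A\<bar> * D" using A' D(2) by (intro mult_right_mono) (auto simp: A_def)
    finally have "real n powr (-r) / pi * (D - pi * \<delta>) \<le> real n powr (-r) / pi * (\<bar>A\<bar> * D)"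
      by (intro mult_left_mono) auto
    then show ?thesis by (simp add: abs_mult field_simps)
  qed
  also have "\<dots> = lpnorm p ?u"
    by (rule lpnorm_cmult_cos_dilate[OF p n D(1), symmetric])
  \<comment> \<open>Reverse triangle inequality: the main term is the deviation minus the
    remainder.\<close>
  also have "\<dots> = lpnorm p (\<lambda>x. (?u x + R x) + - R x)"
    by simp
  also have "\<dots> \<le> lpnorm p (\<lambda>x. ?u x + R x) + ereal (2 * pi * (remainder_const * real (n + 1) powr (-r)))"
    using R remainder_const_pos p gb by (intro lpnorm_add_bounded) auto
  also have "lpnorm p (\<lambda>x. ?u x + R x) \<le> eps_L p n (Wclass \<beta> r 1)"
    unfolding gu[symmetric] eps_L_def by (rule SUP_upper[OF f])
  finally have "ereal (real n powr (-r) * (D / pi - \<delta>))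
      \<le> eps_L p n (Wclass \<beta> r 1) + ereal (2 * pi * (remainder_const * real (n + 1) powr (-r)))"
    by (simp add: add_right_mono)
  then show ?thesis
    by (cases "eps_L p n (Wclass \<beta> r 1)") (auto simp: mult.assoc)
qed

text \<open>Multiplication by \<open>n powr r\<close> turns \<open>(n + 1) powr (-r)\<close> into
  \<open>(1 + 1 / n) powr (-r)\<close>, and letting \<open>\<delta>\<close> tend to zero removes the
  defect left by unattained suprema.\<close>

lemma normalized_estimate:
  assumes n: "n \<ge> 1" and up: "E \<le> ereal (real n powr (-r) * d + K * real (n + 1) powr (-r))"
    and low: "\<And>\<delta>. \<delta> > 0 \<Longrightarrow> ereal (real n powr (-r) * (d - \<delta>) - K * real (n + 1) powr (-r)) \<le> E"
  shows "\<bar>E * ereal (real n powr r) - ereal d\<bar> \<le> ereal (K * (1 + 1 / real n) powr (-r))"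
proof -
  \<comment> \<open>The upper bound and the lower bound at \<open>\<delta> = 1\<close> exclude both
    infinite values.\<close>
  obtain e where E: "E = ereal e"
    using up low[of 1] by (cases E) auto
  have m: "real n powr (-r) * real n powr r = 1"
    using n by (simp flip: powr_add)
  have "real (n + 1) = (1 + 1 / real n) * real n"
    using n by (simp add: field_simps)
  then have k: "real (n + 1) powr (-r) * real n powr r = (1 + 1 / real n) powr (-r)"
    using m by (simp only: powr_mult mult.assoc)
  have scale: "(real n powr (-r) * y + s * real (n + 1) powr (-r)) * real n powr r = y + s * (1 + 1 / real n) powr (-r)" for y s
  proof -
    have "(real n powr (-r) * y + s * real (n + 1) powr (-r)) * real n powr r
        = y * (real n powr (-r) * real n powr r) + s * (real (n + 1) powr (-r) * real n powr r)"
      by (simp only: algebra_simps)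
    then show ?thesis by (simp only: m k mult_1_right)
  qed
  have "e * real n powr r \<le> (real n powr (-r) * d + K * real (n + 1) powr (-r)) * real n powr r"
    using up E by (intro mult_right_mono) auto
  then have 1: "e * real n powr r \<le> d + K * (1 + 1 / real n) powr (-r)"
    unfolding scale .
  have "d - K * (1 + 1 / real n) powr (-r) \<le> e * real n powr r + \<delta>" if "\<delta> > 0" for \<delta>
  proof -
    have "(real n powr (-r) * (d - \<delta>) + (- K) * real (n + 1) powr (-r)) * real n powr r \<le> e * real n powr r"
      using low[OF that] E by (intro mult_right_mono) auto
    then show ?thesis unfolding scale by simp
  qed
  then have 2: "d - K * (1 + 1 / real n) powr (-r) \<le> e * real n powr r"
    by (rule field_le_epsilon)
  from 1 2 show ?thesis by (simp add: E abs_le_iff)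
qed

theorem theorem1:
  shows "\<exists>K::real. \<forall>(p::ereal) (n::nat) (\<beta>::nat \<Rightarrow> real) (r::real).
     1 \<le> p \<longrightarrow> 1 \<le> n \<longrightarrow> real n + 1 \<le> r \<longrightarrow>
       \<bar>eps_C n (Wclass \<beta> r p) * ereal (real n powr r) - ereal (1 / pi) * lpnorm (conj_exp p) cos\<bar>
         \<le> ereal (K * (1 + 1 / real n) powr (-r))
     \<and> \<bar>eps_L p n (Wclass \<beta> r 1) * ereal (real n powr r) - ereal (1 / pi) * lpnorm p cos\<bar>
         \<le> ereal (K * (1 + 1 / real n) powr (-r))"
proof (intro exI allI impI conjI)
  fix p :: ereal and n :: nat and \<beta> :: "nat \<Rightarrow> real" and r :: real
  assume p: "1 \<le> p" and n: "1 \<le> n" and r: "real n + 1 \<le> r"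
  \<comment> \<open>The constant of the integral norms; as \<open>2 * pi \<ge> 1\<close>, it also
    covers the uniform norm.\<close>
  let ?K = "2 * pi * remainder_const"
  obtain D where D: "lpnorm (conj_exp p) cos = ereal D"
    using lpnorm_cos_real[OF conj_exp_ge_1[OF p]] by blast
  have "\<bar>eps_C n (Wclass \<beta> r p) * ereal (real n powr r) - ereal (D / pi)\<bar>
      \<le> ereal (remainder_const * (1 + 1 / real n) powr (-r))"
    using eps_C_upper[OF p n r D] eps_C_lower[OF p n r D] by (rule normalized_estimate[OF n])
  also have "\<dots> \<le> ereal (?K * (1 + 1 / real n) powr (-r))"
    using remainder_const_pos pi_gt3 by (simp add: mult_right_mono)
  finally show "\<bar>eps_C n (Wclass \<beta> r p) * ereal (real n powr r) - ereal (1 / pi) * lpnorm (conj_exp p) cos\<bar>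
      \<le> ereal (?K * (1 + 1 / real n) powr (-r))"
    by (simp add: D)
  obtain D' where D': "lpnorm p cos = ereal D'" "0 \<le> D'"
    using lpnorm_cos_real[OF p] by blast
  have "\<bar>eps_L p n (Wclass \<beta> r 1) * ereal (real n powr r) - ereal (D' / pi)\<bar>
      \<le> ereal (?K * (1 + 1 / real n) powr (-r))"
    using eps_L_upper[OF p n r D'] eps_L_lower[OF p n r D'] by (rule normalized_estimate[OF n])
  then show "\<bar>eps_L p n (Wclass \<beta> r 1) * ereal (real n powr r) - ereal (1 / pi) * lpnorm p cos\<bar>
      \<le> ereal (?K * (1 + 1 / real n) powr (-r))"
    by (simp add: D')
qed

end
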